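(* Let $d_A,d_B\geq 2$ be integers, $d=\min(d_A,d_B)$, let $\alpha,\beta$ be arbitrary real numbers and let $l\geq 1$ be a natural number. For every state (density matrix) $\rho$ on $\mathbb{C}^{d_A}\otimes\mathbb{C}^{d_B}$, the convex-roof extended negativity (CREN) satisfies $$\mathcal{N}(\rho)\geq\frac{\left\|\mathcal{M}_{\alpha,\beta}^{l}(\rho)\right\|_{tr}-\sqrt{(l\alpha^{2}+1)(l\beta^{2}+1)}}{d-1}.$$
   Context: A state on $\mathbb{C}^{d_A}\otimes\mathbb{C}^{d_B}$ is a positive semidefinite $d_Ad_B\times d_Ad_B$ complex matrix of trace $1$. CREN: for a pure state (unit vector) $|\varphi\rangle\in\mathbb{C}^{d_A}\otimes\mathbb{C}^{d_B}$, $\mathcal{N}(|\varphi\rangle)=\dfrac{\|(|\varphi\rangle\langle\varphi|)^{T_B}\|_{tr}-1}{d-1}$, where $T_B$ is the partial transpose on subsystem $B$ and $d=\min(d_A,d_B)$. For a mixed state, $\mathcal{N}(\rho)=\min\sum_i p_i\mathcal{N}(|\varphi_i\rangle)$, the minimum over all pure state decompositions $\rho=\sum_i p_i|\varphi_i\rangle\langle\varphi_i|$ with $p_i\geq 0$, $\sum_i p_i=1$. For $A=[a_{ij}]\in\mathbb{C}^{m\times n}$, $\operatorname{vec}(A)=(a_{11},\dots,a_{m1},a_{12},\dots,a_{m2},\dots,a_{1n},\dots,a_{mn})^T$ (column stacking), $T$ denotes transpose (no conjugation), and $\|A\|_{tr}=\operatorname{tr}\sqrt{A^\dagger A}$ is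 the trace norm. Realignment: if $Z$ is an $m\times m$ block matrix with blocks $Z_{i,j}\in\mathbb{C}^{n\times n}$, then $\mathcal{R}(Z)$ is the $m^2\times n^2$ matrix whose rows are, in order, $\operatorname{vec}(Z_{1,1})^T,\dots,\operatorname{vec}(Z_{m,1})^T,\dots,\operatorname{vec}(Z_{1,m})^T,\dots,\operatorname{vec}(Z_{m,m})^T$. For $\rho$ on $\mathbb{C}^{d_A}\otimes\mathbb{C}^{d_B}$ take $m=d_A$, $n=d_B$. For a matrix $X$, $\omega_l(X)=(\operatorname{vec}(X),\dots,\operatorname{vec}(X))$ is the matrix with $l$ columns all equal to $\operatorname{vec}(X)$. $E_{l\times l}$ is the $l\times l$ matrix with all entries $1$. $\operatorname{tr}_A,\operatorname{tr}_B$ are the partial traces over $A$, $B$. Define $$\mathcal{M}_{\alpha,\beta}^{l}(\rho)=\begin{pmatrix}\alpha\beta E_{l\times l} & \alpha\,\omega_l(\operatorname{tr}_A(\rho))^T\\ \beta\,\omega_l(\operatorname{tr}_B(\rho)) & \mathcal{R}(\rho)\end{pmatrix}\in\mathbb{C}^{(l+d_A^2)\times(l+d_B^2)}.$$ *)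

theory Defs
  imports "Jordan_Normal_Form.Schur_Decomposition"
begin

(* Square matrices, square roots, trace norm *)

definition mat_trace :: "complex mat \<Rightarrow> complex" where
  "mat_trace A = (\<Sum>i<dim_row A. A $$ (i, i))"

(* The order on complex numbers is that of Complex_Order: 0 \<le> z means that z is real and
   nonnegative.  In particular the condition below forces A to be Hermitian. *)
definition psd :: "nat \<Rightarrow> complex mat \<Rightarrow> bool" where
  "psd n A \<longleftrightarrow> A \<in> carrier_mat n n \<and> (\<forall>v \<in> carrier_vec n. 0 \<le> (A *\<^sub>v v) \<bullet>c v)"

(* The positive semidefinite square root of a positive semidefinite matrix (it is unique). *)
definition psd_sqrt :: "complex mat \<Rightarrow> complex mat" where
  "psd_sqrt A = (THE B. psd (dim_row A) B \<and> B * B = A)"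

(* The trace of a positive semidefinite matrix is real, so Re loses nothing. *)
definition trace_norm :: "complex mat \<Rightarrow> real" where
  "trace_norm A = Re (mat_trace (psd_sqrt (mat_adjoint A * A)))"

(* Bipartite systems.  The product basis vector |a> (x) |b> of C^dA (x) C^dB, with a < dA and
   b < dB, has index a * dB + b, so that a matrix on the tensor product is a dA x dA block
   matrix with blocks of size dB x dB. *)

definition block :: "nat \<Rightarrow> complex mat \<Rightarrow> nat \<Rightarrow> nat \<Rightarrow> complex mat" where
  "block n Z i j = mat n n (\<lambda>(k, k'). Z $$ (i * n + k, j * n + k'))"

definition is_state :: "nat \<Rightarrow> nat \<Rightarrow> complex mat \<Rightarrow> bool" where
  "is_state dA dB \<rho> \<longleftrightarrow> psd (dA * dB) \<rho> \<and> mat_trace \<rho> = 1"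

definition is_pure_state :: "nat \<Rightarrow> nat \<Rightarrow> complex vec \<Rightarrow> bool" where
  "is_pure_state dA dB \<phi> \<longleftrightarrow> \<phi> \<in> carrier_vec (dA * dB) \<and> \<phi> \<bullet>c \<phi> = 1"

definition ketbra :: "complex vec \<Rightarrow> complex mat" where
  "ketbra \<phi> = mat (dim_vec \<phi>) (dim_vec \<phi>) (\<lambda>(i, j). \<phi> $ i * cnj (\<phi> $ j))"

(* Every block is transposed and stays in its place. *)
definition partial_transpose_B :: "nat \<Rightarrow> nat \<Rightarrow> complex mat \<Rightarrow> complex mat" where
  "partial_transpose_B dA dB \<rho> = mat (dA * dB) (dA * dB)
     (\<lambda>(r, c). (block dB \<rho> (r div dB) (c div dB))\<^sup>T $$ (r mod dB, c mod dB))"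

definition partial_trace_A :: "nat \<Rightarrow> nat \<Rightarrow> complex mat \<Rightarrow> complex mat" where
  "partial_trace_A dA dB \<rho> = mat dB dB (\<lambda>(b, b'). \<Sum>a<dA. block dB \<rho> a a $$ (b, b'))"

definition partial_trace_B :: "nat \<Rightarrow> nat \<Rightarrow> complex mat \<Rightarrow> complex mat" where
  "partial_trace_B dA dB \<rho> = mat dA dA (\<lambda>(a, a'). mat_trace (block dB \<rho> a a'))"

(* Convex-roof extended negativity *)

definition cren_pure :: "nat \<Rightarrow> nat \<Rightarrow> complex vec \<Rightarrow> real" where
  "cren_pure dA dB \<phi> =
     (trace_norm (partial_transpose_B dA dB (ketbra \<phi>)) - 1) / (real (min dA dB) - 1)"

(* The first n values of p and \<phi> form a pure state decomposition of \<rho>; the number n of terms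
   is arbitrary. *)
definition is_pure_decomposition ::
  "nat \<Rightarrow> nat \<Rightarrow> complex mat \<Rightarrow> nat \<Rightarrow> (nat \<Rightarrow> real) \<Rightarrow> (nat \<Rightarrow> complex vec) \<Rightarrow> bool" where
  "is_pure_decomposition dA dB \<rho> n p \<phi> \<longleftrightarrow>
     (\<forall>i<n. p i \<ge> 0 \<and> is_pure_state dA dB (\<phi> i)) \<and> (\<Sum>i<n. p i) = 1 \<and>
     \<rho> = mat (dA * dB) (dA * dB)
           (\<lambda>rc. \<Sum>i<n. complex_of_real (p i) * ketbra (\<phi> i) $$ rc)"

definition cren_values :: "nat \<Rightarrow> nat \<Rightarrow> complex mat \<Rightarrow> real set" where
  "cren_values dA dB \<rho> =
     {\<Sum>i<n. p i * cren_pure dA dB (\<phi> i) | n p \<phi>. is_pure_decomposition dA dB \<rho> n p \<phi>}"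

(* The minimum over all decompositions, written as an infimum because the set of values is
   infinite in general; cren_eq_minimum identifies the two. *)
definition cren :: "nat \<Rightarrow> nat \<Rightarrow> complex mat \<Rightarrow> real" where
  "cren dA dB \<rho> = Inf (cren_values dA dB \<rho>)"

lemma cren_eq_minimum:
  assumes "m \<in> cren_values dA dB \<rho>" and "\<And>x. x \<in> cren_values dA dB \<rho> \<Longrightarrow> m \<le> x"
  shows "cren dA dB \<rho> = m"
  unfolding cren_def using assms by (rule cInf_eq_minimum)

(* Vectorization, realignment and the matrix M *)

(* column stacking *)
definition vectorize :: "complex mat \<Rightarrow> complex vec" where
  "vectorize A = vec (dim_row A * dim_col A) (\<lambda>k. A $$ (k mod dim_row A, k div dim_row A))"

(* Row r is the vectorization of block (r mod m, r div m): the first block index runs fastest. *)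
definition realign :: "nat \<Rightarrow> nat \<Rightarrow> complex mat \<Rightarrow> complex mat" where
  "realign m n Z =
     mat_of_rows (n\<^sup>2) (map (\<lambda>r. vectorize (block n Z (r mod m) (r div m))) [0..<m\<^sup>2])"

definition omega :: "nat \<Rightarrow> complex mat \<Rightarrow> complex mat" where
  "omega l X = mat_of_cols (dim_row X * dim_col X) (replicate l (vectorize X))"

definition ones_mat :: "nat \<Rightarrow> complex mat" where
  "ones_mat l = mat l l (\<lambda>_. 1)"

definition M_mat :: "nat \<Rightarrow> nat \<Rightarrow> nat \<Rightarrow> real \<Rightarrow> real \<Rightarrow> complex mat \<Rightarrow> complex mat" where
  "M_mat dA dB l \<alpha> \<beta> \<rho> = four_block_mat
     (complex_of_real (\<alpha> * \<beta>) \<cdot>\<^sub>m ones_mat l)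
     (complex_of_real \<alpha> \<cdot>\<^sub>m (omega l (partial_trace_A dA dB \<rho>))\<^sup>T)
     (complex_of_real \<beta> \<cdot>\<^sub>m omega l (partial_trace_B dA dB \<rho>))
     (realign dA dB \<rho>)"

end

theory Submission
  imports Defs "HOL-Analysis.L2_Norm"
begin

text \<open>For a pure state with Schmidt decomposition
  \<open>\<phi> = \<Sum>\<^sub>k s\<^sub>k u\<^sub>k \<otimes> v\<^sub>k\<close> the partially transposed projector has singular values
  \<open>s\<^sub>k s\<^sub>m\<close>, so its trace norm is \<open>(\<Sum>\<^sub>k s\<^sub>k)\<^sup>2\<close>. The matrix
  \<open>M\<close> of \<open>\<phi>\<close> is the sum over \<open>k, m\<close> of rank one matrices
  \<open>s\<^sub>k s\<^sub>m x\<^sub>k\<^sub>m y\<^sub>k\<^sub>m\<^sup>T\<close>, in which the \<open>l\<close> leading entries of the two vectors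
  vanish for \<open>k \<noteq> m\<close> and equal \<open>\<alpha>\<close> and \<open>\<beta>\<close> for \<open>k = m\<close>. The off-diagonal terms contribute at
  most \<open>(\<Sum>\<^sub>k s\<^sub>k)\<^sup>2 - 1\<close> to the trace norm of \<open>M\<close>, the diagonal ones at most the square root in the
  claim because \<open>\<Sum>\<^sub>k s\<^sub>k\<^sup>2 = 1\<close>. The mixed case follows since \<open>M\<close> is affine in \<open>\<rho>\<close> and the trace norm
  is convex.\<close>

section \<open>Orthonormal families\<close>

text \<open>Vectors are functions of which only the first \<open>n\<close> values count: no
  dimension conditions arise, and tensor products and conjugates are plain lambda terms.\<close>

definition cinner :: "nat \<Rightarrow> (nat \<Rightarrow> complex) \<Rightarrow> (nat \<Rightarrow> complex) \<Rightarrow> complex" where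
  "cinner n x y = (\<Sum>i<n. x i * cnj (y i))"

definition cnorm :: "nat \<Rightarrow> (nat \<Rightarrow> complex) \<Rightarrow> real" where
  "cnorm n x = L2_set (\<lambda>i. cmod (x i)) {..<n}"

text \<open>The index type stays open because the partial transpose needs families indexed by pairs
  of Schmidt indices.\<close>

definition orthonormal :: "nat \<Rightarrow> 'k set \<Rightarrow> ('k \<Rightarrow> nat \<Rightarrow> complex) \<Rightarrow> bool" where
  "orthonormal n I u \<longleftrightarrow> (\<forall>k\<in>I. \<forall>l\<in>I. cinner n (u k) (u l) = (if k = l then 1 else 0))"

lemma orthonormalD:
  "orthonormal n I u \<Longrightarrow> k \<in> I \<Longrightarrow> l \<in> I \<Longrightarrow> cinner n (u k) (u l) = (if k = l then 1 else 0)"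
  by (simp add: orthonormal_def)

lemma cinner_commute: "cinner n y x = cnj (cinner n x y)"
  by (simp add: cinner_def mult.commute)

lemma cnorm_nonneg [simp]: "0 \<le> cnorm n x"
  by (simp add: cnorm_def)

lemma cnorm_squared: "(cnorm n x)\<^sup>2 = (\<Sum>i<n. (cmod (x i))\<^sup>2)"
  by (simp add: cnorm_def L2_set_def sum_nonneg)

lemma cinner_self: "cinner n x x = complex_of_real ((cnorm n x)\<^sup>2)"
  by (simp only: cnorm_squared cinner_def of_real_sum complex_norm_square)

lemma cinner_cong:
  "(\<And>i. i < n \<Longrightarrow> x i = x' i) \<Longrightarrow> (\<And>i. i < n \<Longrightarrow> y i = y' i) \<Longrightarrow> cinner n x y = cinner n x' y'"
  by (simp add: cinner_def)

lemma cinner_diff_left: "cinner n (\<lambda>i. x i - y i) z = cinner n x z - cinner n y z"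
  by (simp add: cinner_def algebra_simps sum_subtractf)

lemma cinner_diff_right: "cinner n z (\<lambda>i. x i - y i) = cinner n z x - cinner n z y"
  by (simp add: cinner_def algebra_simps sum_subtractf)

lemma cinner_scale_left: "cinner n (\<lambda>i. c * x i) y = c * cinner n x y"
  by (simp add: cinner_def sum_distrib_left mult.assoc)

lemma cinner_scale_right: "cinner n x (\<lambda>i. c * y i) = cnj c * cinner n x y"
  by (simp add: cinner_def sum_distrib_left mult.left_commute)

lemma cinner_sum_left: "cinner n (\<lambda>i. \<Sum>k\<in>I. c k * u k i) y = (\<Sum>k\<in>I. c k * cinner n (u k) y)"
  unfolding cinner_def sum_distrib_right sum_distrib_left
  by (subst sum.swap) (simp add: mult.assoc)

lemma cinner_sum_right:
  "cinner n x (\<lambda>i. \<Sum>k\<in>I. c k * u k i) = (\<Sum>k\<in>I. cnj (c k) * cinner n x (u k))"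
  by (subst (1 2) cinner_commute) (simp add: cinner_sum_left)

lemma orthonormal_expand:
  assumes "finite I" "orthonormal n I u" "l \<in> I"
  shows "cinner n (\<lambda>i. \<Sum>k\<in>I. c k * u k i) (u l) = c l"
proof -
  have "(\<Sum>k\<in>I. c k * cinner n (u k) (u l)) = (\<Sum>k\<in>I. if k = l then c k else 0)"
    using assms by (intro sum.cong) (auto simp: orthonormalD)
  then show ?thesis
    using assms by (simp add: cinner_sum_left)
qed

text \<open>Subtracting the projection \<open>p\<close> leaves a residual \<open>z\<close>
  orthogonal to \<open>p\<close>, so the squared norm of \<open>z\<close> is exactly the difference
  of the two sides.\<close>

lemma bessel_inequality:
  assumes "finite I" "orthonormal n I u"
  shows "(\<Sum>k\<in>I. (cmod (cinner n x (u k)))\<^sup>2) \<le> (cnorm n x)\<^sup>2"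
proof -
  define c where "c k = cinner n x (u k)" for k
  define p where "p = (\<lambda>i. \<Sum>k\<in>I. c k * u k i)"
  define z where "z = (\<lambda>i. x i - p i)"
  have "cinner n z (u k) = 0" if "k \<in> I" for k
    using orthonormal_expand[OF assms that, of c]
    by (simp add: z_def cinner_diff_left c_def p_def)
  then have zp: "cinner n z p = 0"
    unfolding p_def by (simp add: cinner_sum_right)
  have "cinner n p x = (\<Sum>k\<in>I. c k * cnj (c k))"
    unfolding p_def by (simp add: cinner_sum_left c_def cinner_commute[of n _ x])
  also have "\<dots> = complex_of_real (\<Sum>k\<in>I. (cmod (c k))\<^sup>2)"
    by (simp only: of_real_sum complex_norm_square)
  finally have px: "cinner n p x = complex_of_real (\<Sum>k\<in>I. (cmod (c k))\<^sup>2)" .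
  have "cinner n z z = cinner n z x - cinner n z p"
    by (subst (2) z_def) (simp add: cinner_diff_right)
  also have "\<dots> = cinner n x x - cinner n p x"
    by (simp add: zp) (simp add: z_def cinner_diff_left)
  finally have "complex_of_real ((cnorm n z)\<^sup>2)
      = complex_of_real ((cnorm n x)\<^sup>2 - (\<Sum>k\<in>I. (cmod (c k))\<^sup>2))"
    by (simp only: px cinner_self of_real_diff)
  then have "(cnorm n z)\<^sup>2 = (cnorm n x)\<^sup>2 - (\<Sum>k\<in>I. (cmod (c k))\<^sup>2)"
    by (simp only: of_real_eq_iff)
  then show ?thesis
    using zero_le_power2[of "cnorm n z"] unfolding c_def by linarith
qed

lemma orthonormal_cnorm: "orthonormal n I u \<Longrightarrow> k \<in> I \<Longrightarrow> cnorm n (u k) = 1"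
  using orthonormalD[of n I u k k] cinner_self[of n "u k"] cnorm_nonneg[of n "u k"]
  by (metis of_real_eq_1_iff power2_eq_1_iff abs_of_nonneg abs_minus_cancel abs_1)

text \<open>The squared norms of the family add up to \<open>card I\<close>. Summed entry by entry
  instead, they are the Bessel sums of the \<open>n\<close> standard basis vectors, each at most
  1.\<close>

lemma orthonormal_card_le:
  assumes "finite I" "orthonormal n I u"
  shows "card I \<le> n"
proof -
  define e :: "nat \<Rightarrow> nat \<Rightarrow> complex" where "e i j = (if j = i then 1 else 0)" for i j
  have e: "cinner n (e i) y = cnj (y i)" if "i < n" for i y
  proof -
    have "cinner n (e i) y = (\<Sum>j<n. if j = i then cnj (y j) else 0)"
      unfolding cinner_def e_def by (intro sum.cong) auto
    then show ?thesis using that by simp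
  qed
  have "real (card I) = (\<Sum>k\<in>I. (cnorm n (u k))\<^sup>2)"
    using assms by (simp add: orthonormal_cnorm)
  also have "\<dots> = (\<Sum>i<n. \<Sum>k\<in>I. (cmod (u k i))\<^sup>2)"
    unfolding cnorm_squared by (rule sum.swap)
  also have "\<dots> = (\<Sum>i<n. \<Sum>k\<in>I. (cmod (cinner n (e i) (u k)))\<^sup>2)"
    by (simp add: e)
  also have "\<dots> \<le> (\<Sum>i<n. (cnorm n (e i))\<^sup>2)"
    by (intro sum_mono bessel_inequality assms)
  also have "\<dots> = (\<Sum>i<n. 1)"
  proof (intro sum.cong refl)
    fix i assume "i \<in> {..<n}"
    then have "complex_of_real ((cnorm n (e i))\<^sup>2) = 1"
      unfolding cinner_self[symmetric] by (simp add: e) (simp add: e_def)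
    then show "(cnorm n (e i))\<^sup>2 = 1"
      by (simp only: of_real_eq_1_iff)
  qed
  finally show ?thesis by simp
qed

section \<open>Spectral decomposition of Hermitian matrices\<close>

lemma mat_trace_mult_commute:
  assumes "A \<in> carrier_mat m n" "B \<in> carrier_mat n m"
  shows "mat_trace (A * B) = mat_trace (B * A)"
proof -
  have "mat_trace (A * B) = (\<Sum>i<m. \<Sum>j<n. A $$ (i, j) * B $$ (j, i))"
    using assms by (auto simp: mat_trace_def scalar_prod_def lessThan_atLeast0 intro!: sum.cong)
  also have "\<dots> = (\<Sum>j<n. \<Sum>i<m. B $$ (j, i) * A $$ (i, j))"
    by (subst sum.swap) (simp add: mult.commute)
  also have "\<dots> = mat_trace (B * A)"
    using assms by (auto simp: mat_trace_def scalar_prod_def lessThan_atLeast0 intro!: sum.cong)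
  finally show ?thesis .
qed

lemma mat_trace_similar:
  assumes "A \<in> carrier_mat n n" "similar_mat_wit A B P Q"
  shows "mat_trace A = mat_trace B"
proof -
  note w = similar_mat_witD2[OF assms]
  have "mat_trace A = mat_trace (P * (B * Q))"
    using w by (simp add: assoc_mult_mat[of P n n B n Q n])
  also have "\<dots> = mat_trace (B * Q * P)"
    using w by (intro mat_trace_mult_commute) auto
  also have "B * Q * P = B"
    using w by (simp add: assoc_mult_mat[of B n n Q n P n])
  finally show ?thesis .
qed

text \<open>If all eigenvalues of a Hermitian matrix vanish, its square is similar to the square of a
  strictly upper triangular matrix, hence has trace zero; but this trace is the sum of the
  squared moduli of the entries.\<close>

lemma hermitian_nonzero_eigenvector:
  assumes herm: "\<And>i j. i < n \<Longrightarrow> j < n \<Longrightarrow> h j i = cnj (h i j)"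
    and nz: "p < n" "q < n" "h p q \<noteq> 0"
  obtains e x where "e \<noteq> 0" "cnorm n x = 1"
    "\<And>i. i < n \<Longrightarrow> (\<Sum>j<n. h i j * x j) = complex_of_real e * x i"
proof -
  define A where "A = mat n n (\<lambda>(i, j). h i j)"
  have A: "A \<in> carrier_mat n n" by (simp add: A_def)
  obtain es where es: "char_poly A = (\<Prod>a\<leftarrow>es. [:- a, 1:])"
    using char_poly_factorized[OF A] by blast
  obtain B P Q where "schur_decomposition A es = (B, P, Q)"
    by (metis prod_cases3)
  note schur = schur_decomposition[OF A es this]
  then have sim: "similar_mat_wit A B P Q" and ut: "upper_triangular B" and diag: "diag_mat B = es"
    by auto
  note w = similar_mat_witD2[OF A sim]
  have "\<exists>e\<in>set es. e \<noteq> 0"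
  proof (rule ccontr)
    assume "\<not> ?thesis"
    then have "B $$ (i, i) = 0" if "i < n" for i
      using that w(5) diag unfolding diag_mat_def by auto
    \<comment> \<open>For distinct \<open>i\<close> and \<open>j\<close> one of the two entries lies
      below the diagonal; for \<open>i = j\<close> both are the same vanishing eigenvalue.\<close>
    then have z: "B $$ (i, j) * B $$ (j, i) = 0" if "i < n" "j < n" for i j
      using ut that w(5) by (cases "i < j"; cases "i = j") (auto simp: upper_triangular_def)
    have "similar_mat_wit (A * A) (B * B) P Q"
    proof (rule similar_mat_witI[of _ _ n])
      have "P * (B * B) * Q = P * B * (B * Q)"
        using w by (simp add: assoc_mult_mat[of _ n n _ n _ n])
      also have "B * Q = Q * P * B * Q"
        using w by (simp add: assoc_mult_mat[of _ n n _ n _ n])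
      also have "P * B * (Q * P * B * Q) = P * B * Q * (P * B * Q)"
        using w(4-7) by (simp add: assoc_mult_mat[of _ n n _ n _ n])
      finally show "A * A = P * (B * B) * Q" using w(3) by simp
    qed (use w in auto)
    then have "mat_trace (A * A) = mat_trace (B * B)"
      using A by (intro mat_trace_similar) auto
    also have "\<dots> = 0"
      using w(5) z by (auto simp: mat_trace_def scalar_prod_def intro!: sum.neutral)
    finally have "mat_trace (A * A) = 0" .
    moreover have "mat_trace (A * A) = complex_of_real (\<Sum>i<n. \<Sum>j<n. (cmod (h i j))\<^sup>2)"
      unfolding of_real_sum complex_norm_square
      by (auto simp: mat_trace_def A_def scalar_prod_def herm[symmetric] lessThan_atLeast0
          intro!: sum.cong)
    ultimately have "(\<Sum>i<n. \<Sum>j<n. (cmod (h i j))\<^sup>2) = 0"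
      by (simp only: of_real_eq_0_iff)
    then have "h p q = 0"
      using nz(1,2) by (simp add: sum_nonneg_eq_0_iff sum_nonneg)
    with nz(3) show False by simp
  qed
  then obtain e where e: "e \<in> set es" "e \<noteq> 0" by blast
  then have "poly (char_poly A) e = 0"
    unfolding es poly_prod_list by (induction es) auto
  then obtain v where v: "eigenvector A v e"
    using eigenvalue_root_char_poly[OF A] unfolding eigenvalue_def by blast
  then have vc: "v \<in> carrier_vec n" "v \<noteq> 0\<^sub>v n" and Av: "A *\<^sub>v v = e \<cdot>\<^sub>v v"
    using A unfolding eigenvector_def by auto
  have ev: "(\<Sum>j<n. h i j * v $ j) = e * v $ i" if "i < n" for i
  proof -
    have "(A *\<^sub>v v) $ i = (\<Sum>j<n. h i j * v $ j)"
      using that vc by (auto simp: A_def scalar_prod_def lessThan_atLeast0 intro!: sum.cong)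
    then show ?thesis using that vc Av by simp
  qed
  define r where "r = cnorm n (($) v)"
  have "r \<noteq> 0"
  proof
    assume "r = 0"
    then have "(\<Sum>i<n. (cmod (v $ i))\<^sup>2) = 0"
      unfolding r_def by (simp flip: cnorm_squared)
    then have "v = 0\<^sub>v n"
      using vc(1) by (intro eq_vecI) (auto simp: sum_nonneg_eq_0_iff)
    with vc show False by simp
  qed
  \<comment> \<open>The eigenvalue is real: the form <h v, v> equals its own conjugate because
    \<open>h\<close> is Hermitian, and it is \<open>e\<close> times the nonzero real number
    r^2.\<close>
  have "cinner n (\<lambda>i. \<Sum>j<n. h i j * v $ j) (($) v) = (\<Sum>i<n. \<Sum>j<n. h i j * v $ j * cnj (v $ i))"
    by (simp add: cinner_def sum_distrib_right)
  moreover have "cnj \<dots> = (\<Sum>i<n. \<Sum>j<n. h j i * v $ i * cnj (v $ j))"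
    by (auto simp: herm[symmetric] algebra_simps intro!: sum.cong)
  moreover have "\<dots> = (\<Sum>i<n. \<Sum>j<n. h i j * v $ j * cnj (v $ i))"
    by (rule sum.swap)
  moreover have "cinner n (\<lambda>i. \<Sum>j<n. h i j * v $ j) (($) v) = e * complex_of_real (r\<^sup>2)"
    unfolding r_def cinner_self[symmetric] cinner_scale_left[symmetric]
    by (intro cinner_cong) (auto simp: ev)
  ultimately have "cnj (e * complex_of_real (r\<^sup>2)) = e * complex_of_real (r\<^sup>2)"
    by metis
  with \<open>r \<noteq> 0\<close> have "cnj e = e" by simp
  then have er: "e = complex_of_real (Re e)"
    by (simp add: complex_eq_iff)
  show thesis
  proof (rule that)
    show "Re e \<noteq> 0" using er e(2) by auto
    have "(cnorm n (\<lambda>i. complex_of_real (1 / r) * v $ i))\<^sup>2 = 1"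
      using \<open>r \<noteq> 0\<close> cnorm_squared[of n "($) v", folded r_def, symmetric]
      by (simp add: cnorm_squared norm_mult norm_divide power_mult_distrib power_divide
          flip: sum_divide_distrib)
    then show "cnorm n (\<lambda>i. complex_of_real (1 / r) * v $ i) = 1"
      using cnorm_nonneg[of n "\<lambda>i. complex_of_real (1 / r) * v $ i"]
      unfolding power2_eq_1_iff by linarith
    show "(\<Sum>j<n. h i j * (complex_of_real (1 / r) * v $ j))
        = complex_of_real (Re e) * (complex_of_real (1 / r) * v $ i)" if "i < n" for i
      using ev[OF that] er
      by (simp add: mult.left_commute[of "h _ _"] flip: sum_distrib_left sum_divide_distrib)
  qed
qed

text \<open>A maximal orthonormal family of eigenvectors with nonzero eigenvalues spans the range: otherwise
  the deflated matrix would have a further eigenvector, necessarily orthogonal to the family.\<close>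

lemma hermitian_spectral:
  assumes herm: "\<And>i j. i < n \<Longrightarrow> j < n \<Longrightarrow> h j i = cnj (h i j)"
  obtains r :: nat and d u where "orthonormal n {..<r} u" "\<And>k. k < r \<Longrightarrow> d k \<noteq> 0"
    "\<And>i j. i < n \<Longrightarrow> j < n \<Longrightarrow> h i j = (\<Sum>k<r. complex_of_real (d k) * u k i * cnj (u k j))"
proof -
  define P where "P r u d \<longleftrightarrow> orthonormal n {..<r} u \<and>
    (\<forall>k<r. d k \<noteq> 0 \<and> (\<forall>i<n. (\<Sum>j<n. h i j * u k j) = complex_of_real (d k) * u k i))"
    for r :: nat and u d
  \<comment> \<open>The sizes of such families include 0 and are at most \<open>n\<close> by
    \<open>orthonormal_card_le\<close>, so a largest one exists.\<close>
  have "\<exists>r. (\<exists>u d. P r u d) \<and> (\<forall>r'. (\<exists>u d. P r' u d) \<longrightarrow> r' \<le> r)"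
  proof (rule ex_has_greatest_nat)
    show "\<exists>u d. P 0 u d" by (simp add: P_def orthonormal_def)
    show "\<forall>r. (\<exists>u d. P r u d) \<longrightarrow> r < Suc n"
      by (auto simp: P_def less_Suc_eq_le dest!: orthonormal_card_le[OF finite_lessThan])
  qed
  then obtain r u d where P: "P r u d" and max: "\<And>r' u' d'. P r' u' d' \<Longrightarrow> r' \<le> r"
    by blast
  then have on: "orthonormal n {..<r} u" and d: "\<And>k. k < r \<Longrightarrow> d k \<noteq> 0"
    and ev: "\<And>k i. k < r \<Longrightarrow> i < n \<Longrightarrow> (\<Sum>j<n. h i j * u k j) = complex_of_real (d k) * u k i"
    by (auto simp: P_def)
  define g where "g i j = h i j - (\<Sum>k<r. complex_of_real (d k) * u k i * cnj (u k j))" for i j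
  have g_herm: "g j i = cnj (g i j)" if "i < n" "j < n" for i j
    using herm[OF that] by (simp add: g_def mult.commute mult.left_commute)
  have g_apply: "(\<Sum>j<n. g i j * x j)
      = (\<Sum>j<n. h i j * x j) - (\<Sum>k<r. complex_of_real (d k) * u k i * cinner n x (u k))" for i x
    unfolding g_def cinner_def left_diff_distrib sum_subtractf sum_distrib_left sum_distrib_right
    by (subst (2) sum.swap) (simp add: mult_ac)
  have gu: "(\<Sum>j<n. g i j * u l j) = 0" if "l < r" "i < n" for i l
  proof -
    have "(\<Sum>k<r. complex_of_real (d k) * u k i * cinner n (u l) (u k))
        = (\<Sum>k<r. if k = l then complex_of_real (d k) * u k i else 0)"
      using that on by (intro sum.cong) (auto simp: orthonormalD)
    with that show ?thesis by (simp add: g_apply ev)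
  qed
  have "g p q = 0" if pq: "p < n" "q < n" for p q
  proof (rule ccontr)
    assume "g p q \<noteq> 0"
    from hermitian_nonzero_eigenvector[of n g, OF g_herm pq this]
    obtain e x where e: "e \<noteq> 0" and x: "cnorm n x = 1"
      and gx: "\<And>i. i < n \<Longrightarrow> (\<Sum>j<n. g i j * x j) = complex_of_real e * x i"
      by blast
    \<comment> \<open>As \<open>g\<close> is Hermitian and annihilates \<open>u l\<close>, e <x,
      u_l> = <g x, u_l> = <x, g u_l> = 0, and \<open>e\<close> is nonzero.\<close>
    have xu: "cinner n x (u l) = 0" if "l < r" for l
    proof -
      have "complex_of_real e * cinner n x (u l) = cinner n (\<lambda>i. \<Sum>j<n. g i j * x j) (u l)"
        unfolding cinner_scale_left[symmetric] by (intro cinner_cong) (auto simp: gx)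
      also have "\<dots> = (\<Sum>i<n. \<Sum>j<n. g i j * x j * cnj (u l i))"
        by (simp add: cinner_def sum_distrib_right)
      also have "\<dots> = (\<Sum>j<n. \<Sum>i<n. g i j * x j * cnj (u l i))"
        by (rule sum.swap)
      also have "\<dots> = (\<Sum>j<n. x j * cnj (\<Sum>i<n. g j i * u l i))"
        by (auto simp: sum_distrib_left g_herm[symmetric] mult_ac intro!: sum.cong)
      also have "\<dots> = 0" using that by (simp add: gu)
      finally show ?thesis using e by simp
    qed
    have ux: "cinner n (u l) x = 0" if "l < r" for l
      using xu[OF that] cinner_commute[of n "u l" x] by simp
    \<comment> \<open>By orthogonality the subtracted terms vanish on \<open>x\<close>, so
      \<open>x\<close> is an eigenvector of \<open>h\<close> itself and the family could be
      enlarged.\<close>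
    have "P (Suc r) (u(r := x)) (d(r := e))"
      unfolding P_def
    proof (intro conjI allI impI)
      have "cinner n x x = 1" by (simp add: cinner_self x)
      then show "orthonormal n {..<Suc r} (u(r := x))"
        using on xu ux by (auto simp: orthonormal_def less_Suc_eq)
    next
      fix k i assume "k < Suc r" "i < n"
      then show "(\<Sum>j<n. h i j * (u(r := x)) k j) = complex_of_real ((d(r := e)) k) * (u(r := x)) k i"
        using gx[of i] g_apply[of i x] xu ev by (auto simp: less_Suc_eq)
    qed (use d e in \<open>auto simp: less_Suc_eq\<close>)
    from max[OF this] show False by simp
  qed
  then have "h i j = (\<Sum>k<r. complex_of_real (d k) * u k i * cnj (u k j))" if "i < n" "j < n" for i j
    using that by (simp add: g_def)
  with on d show thesis by (rule that)
qed

section \<open>Singular value decomposition and the trace norm\<close>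

text \<open>Only nonzero singular values are listed, so the families \<open>u\<close> and \<open>v\<close> need not be complete.\<close>

definition has_svd ::
  "complex mat \<Rightarrow> nat \<Rightarrow> nat \<Rightarrow> 'k set \<Rightarrow> ('k \<Rightarrow> real) \<Rightarrow> ('k \<Rightarrow> nat \<Rightarrow> complex) \<Rightarrow> ('k \<Rightarrow> nat \<Rightarrow> complex) \<Rightarrow> bool"
where
  "has_svd A m n I s u v \<longleftrightarrow> A \<in> carrier_mat m n \<and> finite I \<and> orthonormal m I u \<and> orthonormal n I v \<and>
     (\<forall>k\<in>I. 0 < s k) \<and>
     (\<forall>i<m. \<forall>j<n. A $$ (i, j) = (\<Sum>k\<in>I. complex_of_real (s k) * u k i * cnj (v k j)))"

lemma has_svdD:
  assumes "has_svd A m n I s u v"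
  shows "A \<in> carrier_mat m n" "finite I" "orthonormal m I u" "orthonormal n I v"
    "k \<in> I \<Longrightarrow> 0 < s k"
    "i < m \<Longrightarrow> j < n \<Longrightarrow> A $$ (i, j) = (\<Sum>k\<in>I. complex_of_real (s k) * u k i * cnj (v k j))"
  using assms by (auto simp: has_svd_def)

lemma has_svd_apply:
  assumes "has_svd A m n I s u v" "i < m"
  shows "(\<Sum>j<n. A $$ (i, j) * x j) = (\<Sum>k\<in>I. complex_of_real (s k) * cinner n x (v k) * u k i)"
  using assms
  by (simp add: has_svdD(6)[OF assms(1)] cinner_def sum_distrib_left sum_distrib_right)
     (subst sum.swap, simp add: mult_ac)

lemma has_svd_apply_right:
  assumes "has_svd A m n I s u v" "i < m" "l \<in> I"
  shows "(\<Sum>j<n. A $$ (i, j) * v l j) = complex_of_real (s l) * u l i"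
proof -
  note svd = has_svdD[OF assms(1)]
  have "(\<Sum>k\<in>I. complex_of_real (s k) * cinner n (v l) (v k) * u k i)
      = (\<Sum>k\<in>I. if k = l then complex_of_real (s l) * u l i else 0)"
    using assms svd by (intro sum.cong) (auto simp: orthonormalD)
  then show ?thesis
    using assms(3) svd(2) by (simp add: has_svd_apply[OF assms(1,2)])
qed

lemma index_mult_mat_sum:
  assumes "A \<in> carrier_mat m n" "B \<in> carrier_mat n p" "i < m" "j < p"
  shows "(A * B) $$ (i, j) = (\<Sum>k<n. A $$ (i, k) * B $$ (k, j))"
  using assms by (auto simp: scalar_prod_def lessThan_atLeast0 intro!: sum.cong)

text \<open>The right family of \<open>A\<close> is the left family of \<open>B\<close>, so
  orthonormality collapses the double sum to its diagonal.\<close>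

lemma has_svd_mult:
  assumes A: "has_svd A m n I s u v" and B: "has_svd B n p I t v w"
  shows "has_svd (A * B) m p I (\<lambda>k. s k * t k) u w"
  unfolding has_svd_def
proof (intro conjI ballI allI impI)
  fix i j assume ij: "i < m" "j < p"
  have "(A * B) $$ (i, j) = (\<Sum>l<n. A $$ (i, l) * (\<Sum>k\<in>I. complex_of_real (t k) * v k l * cnj (w k j)))"
    using ij unfolding index_mult_mat_sum[OF has_svdD(1)[OF A] has_svdD(1)[OF B] ij]
    by (simp add: has_svdD(6)[OF B])
  also have "\<dots> = (\<Sum>k\<in>I. complex_of_real (t k) * cnj (w k j) * (\<Sum>l<n. A $$ (i, l) * v k l))"
    by (simp add: sum_distrib_left) (subst sum.swap, simp add: mult_ac)
  also have "\<dots> = (\<Sum>k\<in>I. complex_of_real (s k * t k) * u k i * cnj (w k j))"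
    using ij has_svd_apply_right[OF A] by (auto intro!: sum.cong)
  finally show "(A * B) $$ (i, j) = \<dots>" .
qed (use has_svdD[OF A] has_svdD[OF B] in auto)

lemma mat_adjoint_carrier [simp]: "A \<in> carrier_mat m n \<Longrightarrow> mat_adjoint A \<in> carrier_mat n m"
  by (auto simp: mat_adjoint_def)

lemma mat_adjoint_index:
  "A \<in> carrier_mat m n \<Longrightarrow> i < n \<Longrightarrow> j < m \<Longrightarrow> mat_adjoint A $$ (i, j) = cnj (A $$ (j, i))"
  by (auto simp: mat_adjoint_def mat_of_rows_def)

lemma has_svd_adjoint:
  "has_svd A m n I s u v \<Longrightarrow> has_svd (mat_adjoint A) n m I s v u"
  by (auto simp: has_svd_def mat_adjoint_index mult_ac)

section \<open>Positive semidefinite matrices: hermiticity, spectral decomposition and uniqueness of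
  square roots\<close>

lemma psd_iff_form:
  "psd n A \<longleftrightarrow> A \<in> carrier_mat n n \<and>
    (\<forall>x. 0 \<le> (\<Sum>i<n. \<Sum>j<n. A $$ (i, j) * x j * cnj (x i)))"
proof -
  have form: "(A *\<^sub>v v) \<bullet>c v = (\<Sum>i<n. \<Sum>j<n. A $$ (i, j) * v $ j * cnj (v $ i))"
    if "A \<in> carrier_mat n n" "v \<in> carrier_vec n" for v
    using that
    by (auto simp: scalar_prod_def sum_distrib_right lessThan_atLeast0 intro!: sum.cong)
  show ?thesis
  proof (intro iffI conjI allI)
    fix x :: "nat \<Rightarrow> complex" assume A: "psd n A"
    then have "0 \<le> (A *\<^sub>v vec n x) \<bullet>c vec n x"
      by (simp add: psd_def)
    then show "0 \<le> (\<Sum>i<n. \<Sum>j<n. A $$ (i, j) * x j * cnj (x i))"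
      using A by (simp add: form psd_def)
  qed (auto simp: psd_def form)
qed

lemma psd_hermitian:
  assumes A: "psd n A" and ij: "i < n" "j < n"
  shows "A $$ (j, i) = cnj (A $$ (i, j))"
proof -
  have real: "Im (\<Sum>i<n. \<Sum>j<n. A $$ (i, j) * x j * cnj (x i)) = 0" for x :: "nat \<Rightarrow> complex"
    using A unfolding psd_iff_form less_eq_complex_def by auto
  \<comment> \<open>Test vectors e_i + c e_j. The value c = 0 settles the diagonal; opposite signs
    of c cancel the diagonal terms, so that 1 and -1 compare the imaginary parts of the two entries
    and the imaginary units their real parts.\<close>
  define x where "x c k = (if k = i then 1 else if k = j then c else 0 :: complex)" for c k
  have form: "(\<Sum>k<n. \<Sum>l<n. A $$ (k, l) * x c l * cnj (x c k))
    = (\<Sum>k\<in>{i, j}. \<Sum>l\<in>{i, j}. A $$ (k, l) * x c l * cnj (x c k))" for c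
    using ij by (subst (1 2) sum.mono_neutral_right[of "{..<n}" "{i, j}"]) (auto simp: x_def)
  show ?thesis
  proof (cases "i = j")
    case True
    with real[of "x 0"] show ?thesis unfolding form by (simp add: x_def complex_eq_iff)
  next
    case False
    have "Im (A $$ (i, j)) + Im (A $$ (j, i)) = 0"
      using real[of "x 1"] real[of "x (- 1)"] False unfolding form by (simp add: x_def)
    moreover have "Re (A $$ (i, j)) - Re (A $$ (j, i)) = 0"
      using real[of "x \<i>"] real[of "x (- \<i>)"] False unfolding form by (simp add: x_def)
    ultimately show ?thesis by (simp add: complex_eq_iff)
  qed
qed

lemma has_svd_form:
  assumes "has_svd P n n I s v v"
  shows "(\<Sum>i<n. \<Sum>j<n. P $$ (i, j) * x j * cnj (x i))
    = complex_of_real (\<Sum>k\<in>I. s k * (cmod (cinner n x (v k)))\<^sup>2)"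
proof -
  have "(\<Sum>i<n. \<Sum>j<n. P $$ (i, j) * x j * cnj (x i))
      = cinner n (\<lambda>i. \<Sum>k\<in>I. complex_of_real (s k) * cinner n x (v k) * v k i) x"
    by (simp add: cinner_def has_svd_apply[OF assms] flip: sum_distrib_right)
  also have "\<dots> = (\<Sum>k\<in>I. complex_of_real (s k) * (cinner n x (v k) * cnj (cinner n x (v k))))"
    unfolding cinner_sum_left by (simp add: cinner_commute[of n _ x] mult.assoc)
  finally show ?thesis
    by (simp only: of_real_sum of_real_mult complex_norm_square)
qed

lemma has_svd_psd:
  assumes "has_svd P n n I s v v"
  shows "psd n P"
  unfolding psd_iff_form has_svd_form[OF assms]
  using has_svdD[OF assms] by (auto simp: less_eq_complex_def less_imp_le intro!: sum_nonneg)

text \<open>The nonzero eigenvalues are positive because the quadratic form takes the value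
  \<open>d l\<close> at \<open>u l\<close>; the spectral decomposition is therefore a singular value
  decomposition with equal families.\<close>

lemma psd_spectral:
  assumes A: "psd n A"
  obtains r :: nat and d u where "has_svd A n n {..<r} d u u"
proof -
  show thesis
  proof (rule hermitian_spectral[of n "\<lambda>i j. A $$ (i, j)", OF psd_hermitian[OF A]])
    fix r :: nat and d u
    assume on: "orthonormal n {..<r} u" and d: "\<And>k. k < r \<Longrightarrow> d k \<noteq> 0"
      and eq: "\<And>i j. i < n \<Longrightarrow> j < n \<Longrightarrow> A $$ (i, j) = (\<Sum>k<r. complex_of_real (d k) * u k i * cnj (u k j))"
    have "0 < d l" if l: "l < r" for l
    proof -
      have "(\<Sum>j<n. A $$ (i, j) * u l j) = complex_of_real (d l) * u l i" if i: "i < n" for i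
      proof -
        have "(\<Sum>j<n. A $$ (i, j) * u l j)
            = (\<Sum>k<r. complex_of_real (d k) * u k i * cinner n (u l) (u k))"
          using i by (simp add: eq cinner_def sum_distrib_left sum_distrib_right)
            (subst sum.swap, simp add: mult_ac)
        also have "\<dots> = (\<Sum>k<r. if k = l then complex_of_real (d l) * u l i else 0)"
          using l on by (intro sum.cong) (auto simp: orthonormalD)
        finally show ?thesis using l by simp
      qed
      then have "(\<Sum>i<n. \<Sum>j<n. A $$ (i, j) * u l j * cnj (u l i))
          = cinner n (\<lambda>i. complex_of_real (d l) * u l i) (u l)"
        by (simp add: cinner_def flip: sum_distrib_right)
      moreover have "\<dots> = complex_of_real (d l)"
        using on l by (simp add: cinner_scale_left orthonormalD)
      moreover have "0 \<le> (\<Sum>i<n. \<Sum>j<n. A $$ (i, j) * u l j * cnj (u l i))"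
        using A unfolding psd_iff_form by blast
      ultimately have "0 \<le> complex_of_real (d l)" by simp
      with d[OF l] show ?thesis by (simp add: less_eq_complex_def)
    qed
    with on eq A have "has_svd A n n {..<r} d u u"
      by (auto simp: has_svd_def psd_def)
    then show thesis by (rule that)
  qed
qed

text \<open>Two diagonalizations of one matrix: an eigenvector \<open>w l\<close> has components
  only along those \<open>u k\<close> whose eigenvalue agrees with \<open>t l\<close>. Since
  \<open>t l\<close> is nonzero, \<open>w l\<close> lies in the range of \<open>H\<close>, which is
  spanned by the \<open>u k\<close>.\<close>

lemma spectral_compare:
  assumes I: "has_svd H n n I s u u" and J: "has_svd H n n J t w w" and l: "l \<in> J"
  shows "k \<in> I \<Longrightarrow> complex_of_real (s k) * cinner n (w l) (u k) = complex_of_real (t l) * cinner n (w l) (u k)"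
    and "i < n \<Longrightarrow> w l i = (\<Sum>k\<in>I. cinner n (w l) (u k) * u k i)"
proof -
  have eq: "complex_of_real (t l) * w l i
      = (\<Sum>k\<in>I. complex_of_real (s k) * cinner n (w l) (u k) * u k i)" if "i < n" for i
    using has_svd_apply[OF I that, of "w l"] has_svd_apply_right[OF J that l] by simp
  show coef: "complex_of_real (s k) * cinner n (w l) (u k) = complex_of_real (t l) * cinner n (w l) (u k)"
    if "k \<in> I" for k
  proof -
    have "complex_of_real (t l) * cinner n (w l) (u k)
        = cinner n (\<lambda>i. complex_of_real (t l) * w l i) (u k)"
      by (simp add: cinner_scale_left)
    also have "\<dots> = cinner n (\<lambda>i. \<Sum>k\<in>I. complex_of_real (s k) * cinner n (w l) (u k) * u k i) (u k)"
      by (intro cinner_cong) (auto simp: eq)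
    also have "\<dots> = complex_of_real (s k) * cinner n (w l) (u k)"
      using that has_svdD[OF I] by (intro orthonormal_expand)
    finally show ?thesis by (rule sym)
  qed
  show "w l i = (\<Sum>k\<in>I. cinner n (w l) (u k) * u k i)" if "i < n"
  proof -
    have "complex_of_real (t l) * w l i = complex_of_real (t l) * (\<Sum>k\<in>I. cinner n (w l) (u k) * u k i)"
      unfolding eq[OF that] sum_distrib_left
      by (intro sum.cong refl) (simp add: coef flip: mult.assoc)
    then show ?thesis using has_svdD(5)[OF J l] by simp
  qed
qed

text \<open>The eigenbases of \<open>B\<close> and of \<open>C\<close> both diagonalize the common
  square. If \<open>u k\<close> and \<open>w l\<close> are not orthogonal, their squared eigenvalues
  agree, and by positivity so do the eigenvalues themselves.\<close>

lemma psd_square_inj: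
  assumes B: "psd n B" and C: "psd n C" and eq: "B * B = C * C"
  shows "B = C"
proof -
  obtain r b u where Bu: "has_svd B n n {..<r :: nat} b u u" by (rule psd_spectral[OF B])
  obtain q c w where Cw: "has_svd C n n {..<q :: nat} c w w" by (rule psd_spectral[OF C])
  have BB: "has_svd (B * B) n n {..<r} (\<lambda>k. b k * b k) u u" by (rule has_svd_mult[OF Bu Bu])
  have CC: "has_svd (B * B) n n {..<q} (\<lambda>k. c k * c k) w w" unfolding eq by (rule has_svd_mult[OF Cw Cw])
  have coef: "complex_of_real (b k) * cinner n (w l) (u k) = complex_of_real (c l) * cinner n (w l) (u k)"
    if kl: "k < r" "l < q" for k l
  proof (cases "cinner n (w l) (u k) = 0")
    case False
    then have "complex_of_real (b k * b k) = complex_of_real (c l * c l)"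
      using spectral_compare(1)[OF BB CC, of l k] kl by simp
    then have "(b k)\<^sup>2 = (c l)\<^sup>2" by (simp only: of_real_eq_iff power2_eq_square)
    then have "b k = c l"
      using has_svdD(5)[OF Bu, of k] has_svdD(5)[OF Cw, of l] kl
      by (simp add: power2_eq_iff_nonneg)
    then show ?thesis by simp
  qed simp
  have "B $$ (i, j) = C $$ (i, j)" if ij: "i < n" "j < n" for i j
  proof -
    \<comment> \<open>Expand the second copy of \<open>u k\<close> in the basis \<open>w\<close>,
      exchange \<open>b k\<close> for \<open>c l\<close> by \<open>coef\<close>, and collect the sum
      over \<open>k\<close> into \<open>w l\<close>.\<close>
    have "B $$ (i, j) = (\<Sum>k<r. complex_of_real (b k) * u k i *
        cnj (\<Sum>l<q. cinner n (u k) (w l) * w l j))"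
      using ij by (auto simp: has_svdD(6)[OF Bu] simp flip: spectral_compare(2)[OF CC BB]
          intro!: sum.cong)
    also have "\<dots> = (\<Sum>l<q. \<Sum>k<r. complex_of_real (b k) * cinner n (w l) (u k) * u k i * cnj (w l j))"
      by (subst sum.swap) (simp add: sum_distrib_left cinner_commute[of n "w _" "u _"] mult_ac)
    also have "\<dots> = (\<Sum>l<q. complex_of_real (c l) * (\<Sum>k<r. cinner n (w l) (u k) * u k i) * cnj (w l j))"
      by (auto simp: coef sum_distrib_left sum_distrib_right mult.assoc intro!: sum.cong)
    also have "\<dots> = C $$ (i, j)"
      using ij by (auto simp: has_svdD(6)[OF Cw] simp flip: spectral_compare(2)[OF BB CC]
          intro!: sum.cong)
    finally show ?thesis .
  qed
  then show ?thesis
    using B C by (auto simp: psd_def)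
qed

section \<open>The square root, the trace norm as sum of singular values, and existence of the
  decomposition\<close>

lemma psd_sqrt_eqI:
  assumes "psd n P"
  shows "psd_sqrt (P * P) = P"
  unfolding psd_sqrt_def
proof (rule the_equality)
  have "dim_row P = n" using assms by (auto simp: psd_def)
  then show "psd (dim_row (P * P)) P \<and> P * P = P * P" using assms by simp
  show "B = P" if "psd (dim_row (P * P)) B \<and> B * B = P * P" for B
    using that assms \<open>dim_row P = n\<close> psd_square_inj by auto
qed

lemma has_svd_trace:
  assumes "has_svd P n n I s v v"
  shows "mat_trace P = complex_of_real (\<Sum>k\<in>I. s k)"
proof -
  note svd = has_svdD[OF assms]
  have "mat_trace P = (\<Sum>i<n. \<Sum>k\<in>I. complex_of_real (s k) * v k i * cnj (v k i))"
    using svd(1) by (auto simp: mat_trace_def svd(6))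
  also have "\<dots> = (\<Sum>k\<in>I. complex_of_real (s k) * cinner n (v k) (v k))"
    by (subst sum.swap) (simp add: cinner_def sum_distrib_left mult.assoc)
  also have "\<dots> = (\<Sum>k\<in>I. complex_of_real (s k))"
    using svd by (intro sum.cong) (auto simp: orthonormalD)
  finally show ?thesis by simp
qed

text \<open>The matrix with eigenvalues \<open>s k\<close> on the right family is positive
  semidefinite and squares to the Gram matrix of \<open>A\<close>, hence it is the square root in
  \<open>trace_norm\<close>; its trace is the sum of the \<open>s k\<close>.\<close>

lemma trace_norm_svd:
  assumes A: "has_svd A m n I s u v"
  shows "trace_norm A = (\<Sum>k\<in>I. s k)"
proof -
  note svd = has_svdD[OF A]
  define P where "P = mat n n (\<lambda>(i, j). \<Sum>k\<in>I. complex_of_real (s k) * v k i * cnj (v k j))"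
  have P: "has_svd P n n I s v v"
    using svd by (auto simp: has_svd_def P_def)
  have PP: "has_svd (P * P) n n I (\<lambda>k. s k * s k) v v"
    by (rule has_svd_mult[OF P P])
  have AA: "has_svd (mat_adjoint A * A) n n I (\<lambda>k. s k * s k) v v"
    by (rule has_svd_mult[OF has_svd_adjoint[OF A] A])
  have "mat_adjoint A * A = P * P"
    using has_svdD(1)[OF PP] has_svdD(1)[OF AA]
    by (intro eq_matI) (auto simp: has_svdD(6)[OF PP] has_svdD(6)[OF AA] simp del: index_mult_mat)
  then have "psd_sqrt (mat_adjoint A * A) = P"
    using psd_sqrt_eqI[OF has_svd_psd[OF P]] by simp
  then show ?thesis
    by (simp add: trace_norm_def has_svd_trace[OF P])
qed

text \<open>Diagonalize the Gram matrix \<open>?H\<close> of \<open>A\<close> with eigenvectors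
  \<open>v k\<close>, take \<open>s k\<close> as the square roots of its eigenvalues, and put u_k =
  A v_k / s_k.\<close>

lemma svd_exists:
  assumes A: "A \<in> carrier_mat m n"
  obtains r :: nat and s u v where "has_svd A m n {..<r} s u v"
proof -
  define ap where "ap x i = (\<Sum>j<n. A $$ (i, j) * x j)" for x i
  let ?H = "mat_adjoint A * A"
  have H: "?H \<in> carrier_mat n n" by (rule mult_carrier_mat[OF mat_adjoint_carrier[OF A] A])
  have H_index: "?H $$ (i, j) = (\<Sum>k<m. cnj (A $$ (k, i)) * A $$ (k, j))" if "i < n" "j < n" for i j
    using that A by (simp add: index_mult_mat_sum[OF mat_adjoint_carrier[OF A] A] mat_adjoint_index)
  have "(\<Sum>j<n. ?H $$ (i, j) * x j) = (\<Sum>k<m. cnj (A $$ (k, i)) * ap x k)" if "i < n" for i x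
    using that by (simp add: H_index ap_def sum_distrib_left sum_distrib_right del: index_mult_mat)
      (subst sum.swap, simp add: mult_ac)
  \<comment> \<open>The identity <H x, y> = <A x, A y>. It yields positivity of \<open>?H\<close>,
    orthonormality of \<open>u\<close>, and that \<open>A\<close> vanishes on the kernel of
    \<open>?H\<close>.\<close>
  then have form: "(\<Sum>i<n. (\<Sum>j<n. ?H $$ (i, j) * x j) * cnj (y i)) = cinner m (ap x) (ap y)" for x y
    by (simp add: cinner_def ap_def[of y] sum_distrib_left sum_distrib_right del: index_mult_mat)
      (subst sum.swap, simp add: mult_ac)
  have "psd n ?H"
    unfolding psd_iff_form using H form[of x x for x]
    by (simp add: sum_distrib_right cinner_self less_eq_complex_def)
  then obtain r :: nat and d v where Hv: "has_svd ?H n n {..<r} d v v"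
    by (rule psd_spectral)
  note svd = has_svdD[OF Hv]
  define s where "s k = sqrt (d k)" for k
  have s: "0 < s k" "complex_of_real (d k) = complex_of_real (s k) * complex_of_real (s k)" if "k < r" for k
    using svd(5)[of k] that by (auto simp: s_def simp flip: of_real_mult)
  define u where "u k i = inverse (complex_of_real (s k)) * ap (v k) i" for k i
  have "orthonormal m {..<r} u"
    unfolding orthonormal_def
  proof (intro ballI)
    fix k l assume kl: "k \<in> {..<r}" "l \<in> {..<r}"
    have "cinner m (ap (v k)) (ap (v l)) = (\<Sum>i<n. (\<Sum>j<n. ?H $$ (i, j) * v k j) * cnj (v l i))"
      by (rule form[symmetric])
    also have "\<dots> = cinner n (\<lambda>i. complex_of_real (d k) * v k i) (v l)"
      unfolding cinner_def using kl
      by (intro sum.cong) (auto simp: has_svd_apply_right[OF Hv] simp del: index_mult_mat)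
    also have "\<dots> = (if k = l then complex_of_real (d k) else 0)"
      using kl svd(4) by (simp add: cinner_scale_left orthonormalD)
    finally show "cinner m (u k) (u l) = (if k = l then 1 else 0)"
      using s[of k] s[of l] kl unfolding u_def cinner_scale_left cinner_scale_right
      by (auto simp: field_simps)
  qed
  moreover have "A $$ (i, j) = (\<Sum>k<r. complex_of_real (s k) * u k i * cnj (v k j))"
    if ij: "i < m" "j < n" for i j
  proof -
    \<comment> \<open>The part of the standard basis vector e_j orthogonal to all
      \<open>v k\<close>. It is killed by \<open>?H\<close>, hence by \<open>A\<close>, so column
      \<open>j\<close> of \<open>A\<close> comes from the \<open>v k\<close> alone.\<close>
    define x where "x l = (if l = j then 1 else 0) - (\<Sum>k<r. cnj (v k j) * v k l)" for l
    have "cinner n x (v k) = 0" if "k < r" for k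
    proof -
      have "cinner n (\<lambda>l. if l = j then 1 else 0) (v k) = (\<Sum>l<n. if l = j then cnj (v k l) else 0)"
        unfolding cinner_def by (intro sum.cong) auto
      then show ?thesis
        using that ij svd(4) orthonormal_expand[of "{..<r}" n v k "\<lambda>k. cnj (v k j)"]
        unfolding x_def by (simp add: cinner_diff_left)
    qed
    then have "cinner m (ap x) (ap x) = 0"
      unfolding form[symmetric] by (simp add: has_svd_apply[OF Hv] del: index_mult_mat)
    then have "(\<Sum>i<m. (cmod (ap x i))\<^sup>2) = 0"
      unfolding cinner_self cnorm_squared of_real_eq_0_iff .
    then have "ap x i = 0"
      using ij by (simp add: sum_nonneg_eq_0_iff)
    moreover have "ap x i = A $$ (i, j) - (\<Sum>k<r. cnj (v k j) * ap (v k) i)"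
    proof -
      have "ap x i = (\<Sum>l<n. if l = j then A $$ (i, l) else 0)
          - (\<Sum>l<n. \<Sum>k<r. A $$ (i, l) * (cnj (v k j) * v k l))"
        unfolding ap_def x_def sum_subtractf[symmetric]
        by (intro sum.cong) (auto simp: algebra_simps sum_distrib_left)
      also have "(\<Sum>l<n. \<Sum>k<r. A $$ (i, l) * (cnj (v k j) * v k l)) = (\<Sum>k<r. cnj (v k j) * ap (v k) i)"
        unfolding ap_def by (subst sum.swap) (simp add: sum_distrib_left mult_ac)
      finally show ?thesis using ij by simp
    qed
    moreover have "complex_of_real (s k) * u k i = ap (v k) i" if "k < r" for k
      using s(1)[OF that] by (simp add: u_def)
    ultimately show ?thesis by (simp add: mult.commute)
  qed
  ultimately have "has_svd A m n {..<r} s u v"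
    using A svd s by (simp add: has_svd_def)
  then show thesis by (rule that)
qed

section \<open>Trace norm estimates\<close>

text \<open>Each singular value is s_k = <A v_k, u_k>. Inserting the rank one terms and summing over
  \<open>k\<close>, Cauchy-Schwarz and Bessel bound the contribution of each term by the product of
  its two norms. All upper bounds on trace norms below rest on this.\<close>

lemma trace_norm_rank_one_sum_le:
  assumes A: "A \<in> carrier_mat m n" and Q: "finite Q"
    and eq: "\<And>i j. i < m \<Longrightarrow> j < n \<Longrightarrow> A $$ (i, j) = (\<Sum>q\<in>Q. x q i * y q j)"
  shows "trace_norm A \<le> (\<Sum>q\<in>Q. cnorm m (x q) * cnorm n (y q))"
proof -
  obtain r :: nat and s u v where svd: "has_svd A m n {..<r} s u v" by (rule svd_exists[OF A])
  \<comment> \<open>Conjugated because \<open>cinner\<close> conjugates its second argument, whereas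
    the rank one terms use a plain transpose.\<close>
  define y' where "y' q = (\<lambda>j. cnj (y q j))" for q
  have y': "cnorm n (y' q) = cnorm n (y q)" for q
    by (simp add: cnorm_def y'_def)
  have s_eq: "complex_of_real (s k) = (\<Sum>q\<in>Q. cinner n (v k) (y' q) * cinner m (x q) (u k))"
    if k: "k < r" for k
  proof -
    have "complex_of_real (s k) = cinner m (\<lambda>i. complex_of_real (s k) * u k i) (u k)"
      using k has_svdD(3)[OF svd] by (simp add: cinner_scale_left orthonormalD)
    also have "\<dots> = cinner m (\<lambda>i. \<Sum>q\<in>Q. cinner n (v k) (y' q) * x q i) (u k)"
    proof (rule cinner_cong)
      fix i assume i: "i < m"
      then have "complex_of_real (s k) * u k i = (\<Sum>j<n. A $$ (i, j) * v k j)"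
        using has_svd_apply_right[OF svd i, of k] k by simp
      also have "\<dots> = (\<Sum>q\<in>Q. cinner n (v k) (y' q) * x q i)"
        using i by (simp add: eq cinner_def y'_def sum_distrib_right)
          (subst sum.swap, simp add: mult_ac)
      finally show "complex_of_real (s k) * u k i = (\<Sum>q\<in>Q. cinner n (v k) (y' q) * x q i)" .
    qed simp
    finally show ?thesis by (simp add: cinner_sum_left)
  qed
  have "trace_norm A = (\<Sum>k<r. s k)" by (rule trace_norm_svd[OF svd])
  also have "\<dots> \<le> (\<Sum>k<r. \<Sum>q\<in>Q. cmod (cinner n (y' q) (v k)) * cmod (cinner m (x q) (u k)))"
  proof (rule sum_mono)
    fix k assume "k \<in> {..<r}"
    then have k: "k < r" by simp
    have "s k = cmod (complex_of_real (s k))"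
      using has_svdD(5)[OF svd, of k] k by simp
    also have "\<dots> \<le> (\<Sum>q\<in>Q. cmod (cinner n (v k) (y' q) * cinner m (x q) (u k)))"
      unfolding s_eq[OF k] by (rule norm_sum)
    finally show "s k \<le> (\<Sum>q\<in>Q. cmod (cinner n (y' q) (v k)) * cmod (cinner m (x q) (u k)))"
      by (simp add: norm_mult cinner_commute[of n "v k"])
  qed
  also have "\<dots> = (\<Sum>q\<in>Q. \<Sum>k<r. cmod (cinner n (y' q) (v k)) * cmod (cinner m (x q) (u k)))"
    by (rule sum.swap)
  also have "\<dots> \<le> (\<Sum>q\<in>Q. cnorm m (x q) * cnorm n (y q))"
  proof (rule sum_mono)
    fix q
    have "(\<Sum>k<r. cmod (cinner n (y' q) (v k)) * cmod (cinner m (x q) (u k)))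
        \<le> L2_set (\<lambda>k. cmod (cinner n (y' q) (v k))) {..<r} * L2_set (\<lambda>k. cmod (cinner m (x q) (u k))) {..<r}"
      using L2_set_mult_ineq[of "\<lambda>k. cmod (cinner n (y' q) (v k))" "\<lambda>k. cmod (cinner m (x q) (u k))"]
      by simp
    also have "\<dots> \<le> cnorm n (y' q) * cnorm m (x q)"
      unfolding L2_set_def
      using has_svdD(2-4)[OF svd]
      by (intro mult_mono real_le_lsqrt bessel_inequality) (auto intro: sum_nonneg real_sqrt_ge_zero)
    finally show "(\<Sum>k<r. cmod (cinner n (y' q) (v k)) * cmod (cinner m (x q) (u k))) \<le> cnorm m (x q) * cnorm n (y q)"
      by (simp add: y' mult.commute)
  qed
  finally show ?thesis .
qed

lemma cnorm_scale: "cnorm n (\<lambda>i. c * x i) = cmod c * cnorm n x"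
  by (simp add: cnorm_def norm_mult L2_set_right_distrib)

lemma cnorm_cnj: "cnorm n (\<lambda>i. cnj (x i)) = cnorm n x"
  by (simp add: cnorm_def)

text \<open>The triangle inequality: singular value decompositions of all \<open>B q\<close> give a
  rank one expansion of \<open>A\<close>.\<close>

lemma trace_norm_combination_le:
  assumes A: "A \<in> carrier_mat m n" and Q: "finite Q" and B: "\<And>q. q \<in> Q \<Longrightarrow> B q \<in> carrier_mat m n"
    and eq: "\<And>i j. i < m \<Longrightarrow> j < n \<Longrightarrow> A $$ (i, j) = (\<Sum>q\<in>Q. c q * B q $$ (i, j))"
  shows "trace_norm A \<le> (\<Sum>q\<in>Q. cmod (c q) * trace_norm (B q))"
proof -
  have "\<exists>r s u v. has_svd (B q) m n {..<r :: nat} s u v" if "q \<in> Q" for q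
    using svd_exists[OF B[OF that]] by metis
  then obtain r s u v where svd: "\<And>q. q \<in> Q \<Longrightarrow> has_svd (B q) m n {..<r q :: nat} (s q) (u q) (v q)"
    by metis
  \<comment> \<open>All weights go into the left vectors, whose norms become
    \<open>cmod (c q) * s q k\<close>; the right vectors stay unit vectors.\<close>
  define x where "x = (\<lambda>(q, k) i. (c q * complex_of_real (s q k)) * u q k i)"
  define y where "y = (\<lambda>(q, k) j. cnj (v q k j))"
  have "trace_norm A \<le> (\<Sum>z\<in>(SIGMA q:Q. {..<r q}). cnorm m (x z) * cnorm n (y z))"
  proof (rule trace_norm_rank_one_sum_le[OF A])
    fix i j assume ij: "i < m" "j < n"
    have "A $$ (i, j) = (\<Sum>q\<in>Q. \<Sum>k<r q. x (q, k) i * y (q, k) j)"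
      using ij by (auto simp: eq has_svdD(6)[OF svd] x_def y_def sum_distrib_left mult_ac intro!: sum.cong)
    then show "A $$ (i, j) = (\<Sum>z\<in>(SIGMA q:Q. {..<r q}). x z i * y z j)"
      using Q by (simp add: sum.Sigma case_prod_beta)
  qed (use Q in auto)
  also have "\<dots> = (\<Sum>q\<in>Q. \<Sum>k<r q. cnorm m (x (q, k)) * cnorm n (y (q, k)))"
    using Q by (simp add: sum.Sigma case_prod_beta)
  also have "\<dots> = (\<Sum>q\<in>Q. \<Sum>k<r q. cmod (c q) * s q k)"
  proof (intro sum.cong refl)
    fix q k assume qk: "q \<in> Q" "k \<in> {..<r q}"
    note D = has_svdD[OF svd[OF qk(1)]]
    show "cnorm m (x (q, k)) * cnorm n (y (q, k)) = cmod (c q) * s q k"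
      using orthonormal_cnorm[OF D(3) qk(2)] orthonormal_cnorm[OF D(4) qk(2)] D(5)[OF qk(2)]
      unfolding x_def y_def prod.case cnorm_scale cnorm_cnj by (simp add: norm_mult)
  qed
  also have "\<dots> = (\<Sum>q\<in>Q. cmod (c q) * trace_norm (B q))"
    by (simp add: trace_norm_svd[OF svd] sum_distrib_left)
  finally show ?thesis .
qed

section \<open>Index arithmetic and norms for tensor products and stacked vectors\<close>

lemma product_index_less:
  assumes "a < m" "b < n"
  shows "a * n + b < m * (n :: nat)"
proof -
  have "a * n + b < Suc a * n" using assms by simp
  also have "\<dots> \<le> m * n" using assms by (intro mult_le_mono1) simp
  finally show ?thesis .
qed

lemma square_index_div_mod_less:
  assumes "k < n\<^sup>2"
  shows "k mod n < (n :: nat)" "k div n < n"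
  using assms by (auto simp: power2_eq_square less_mult_imp_div_less intro!: mod_less_divisor intro: gr0I)

lemma sum_div_mod: "(\<Sum>r<m * n. f (r div n) (r mod n)) = (\<Sum>a<m. \<Sum>b<n. f a (b :: nat))"
  unfolding sum.cartesian_product
  by (rule sum.reindex_bij_witness[of _ "\<lambda>(a, b). a * n + b" "\<lambda>r. (r div n, r mod n)"])
    (auto simp: product_index_less less_mult_imp_div_less intro!: mod_less_divisor intro: gr0I)

lemma cinner_tensor:
  "cinner (m * n) (\<lambda>r. x (r div n) * y (r mod n)) (\<lambda>r. x' (r div n) * y' (r mod n))
    = cinner m x x' * cinner n y y'"
  unfolding cinner_def sum_product
  by (subst sum_div_mod[symmetric]) (simp add: mult_ac)

lemma cinner_cnj: "cinner n (\<lambda>i. cnj (x i)) (\<lambda>i. cnj (y i)) = cinner n y x"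
  by (simp add: cinner_def mult.commute)

lemma orthonormal_cnj: "orthonormal n I u \<Longrightarrow> orthonormal n I (\<lambda>k i. cnj (u k i))"
  by (simp add: orthonormal_def cinner_cnj)

lemma cnorm_tensor:
  "cnorm (m * n) (\<lambda>r. x (r div n) * y (r mod n)) = cnorm m x * cnorm n y"
proof -
  have "complex_of_real ((cnorm (m * n) (\<lambda>r. x (r div n) * y (r mod n)))\<^sup>2)
      = complex_of_real ((cnorm m x * cnorm n y)\<^sup>2)"
    unfolding cinner_self[symmetric] cinner_tensor by (simp add: cinner_self power_mult_distrib)
  then have "(cnorm (m * n) (\<lambda>r. x (r div n) * y (r mod n)))\<^sup>2 = (cnorm m x * cnorm n y)\<^sup>2"
    by (simp only: of_real_eq_iff)
  then show ?thesis
    by (rule power2_eq_imp_eq) simp_all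
qed

text \<open>The constant block of length \<open>l\<close> is what produces the terms
  \<open>real l * \<alpha>\<^sup>2 + 1\<close> and \<open>real l * \<beta>\<^sup>2 + 1\<close> once
  \<open>z\<close> is a unit vector.\<close>

lemma cnorm_append:
  "cnorm (l + m) (\<lambda>i. if i < l then c else z (i - l)) = sqrt (real l * (cmod c)\<^sup>2 + (cnorm m z)\<^sup>2)"
proof -
  have "(\<Sum>i<l + m. (cmod (if i < l then c else z (i - l)))\<^sup>2)
      = real l * (cmod c)\<^sup>2 + (\<Sum>i<m. (cmod (z i))\<^sup>2)"
    by (induction m) auto
  then show ?thesis
    unfolding cnorm_squared by (simp add: cnorm_def L2_set_def)
qed

text \<open>Applied to the coefficient matrix of a unit vector, this gives the normalization of the
  Schmidt coefficients.\<close>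

lemma has_svd_frobenius:
  assumes "has_svd A m n I s u v"
  shows "(\<Sum>i<m. \<Sum>j<n. A $$ (i, j) * cnj (A $$ (i, j))) = complex_of_real (\<Sum>k\<in>I. (s k)\<^sup>2)"
proof -
  note svd = has_svdD[OF assms]
  have "(\<Sum>j<n. A $$ (i, j) * cnj (A $$ (i, j)))
      = (\<Sum>k\<in>I. complex_of_real ((s k)\<^sup>2) * (u k i * cnj (u k i)))" if i: "i < m" for i
  proof -
    have "(\<Sum>j<n. A $$ (i, j) * cnj (A $$ (i, j)))
        = (\<Sum>j<n. A $$ (i, j) * cnj (\<Sum>k\<in>I. complex_of_real (s k) * u k i * cnj (v k j)))"
      using i by (intro sum.cong) (auto simp: svd(6))
    also have "\<dots> = (\<Sum>k\<in>I. complex_of_real (s k) * cnj (u k i) * (\<Sum>j<n. A $$ (i, j) * v k j))"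
      by (simp add: sum_distrib_left) (subst sum.swap, simp add: mult_ac)
    also have "\<dots> = (\<Sum>k\<in>I. complex_of_real ((s k)\<^sup>2) * (u k i * cnj (u k i)))"
      using i by (intro sum.cong) (auto simp: has_svd_apply_right[OF assms] power2_eq_square)
    finally show ?thesis .
  qed
  then have "(\<Sum>i<m. \<Sum>j<n. A $$ (i, j) * cnj (A $$ (i, j)))
      = (\<Sum>i<m. \<Sum>k\<in>I. complex_of_real ((s k)\<^sup>2) * (u k i * cnj (u k i)))"
    by (intro sum.cong) auto
  also have "\<dots> = (\<Sum>k\<in>I. complex_of_real ((s k)\<^sup>2) * cinner m (u k) (u k))"
    by (subst sum.swap) (simp add: cinner_def sum_distrib_left)
  also have "\<dots> = (\<Sum>k\<in>I. complex_of_real ((s k)\<^sup>2))"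
    using svd by (intro sum.cong) (auto simp: orthonormalD)
  finally show ?thesis by simp
qed

section \<open>Schmidt decomposition of pure states\<close>

text \<open>Unlike in \<open>has_svd\<close>, the second family enters without conjugation, as a
  ket.\<close>

definition schmidt ::
  "nat \<Rightarrow> nat \<Rightarrow> complex vec \<Rightarrow> 'k set \<Rightarrow> ('k \<Rightarrow> real) \<Rightarrow> ('k \<Rightarrow> nat \<Rightarrow> complex) \<Rightarrow> ('k \<Rightarrow> nat \<Rightarrow> complex) \<Rightarrow> bool"
where
  "schmidt dA dB \<phi> I s u v \<longleftrightarrow> \<phi> \<in> carrier_vec (dA * dB) \<and> finite I \<and>
     orthonormal dA I u \<and> orthonormal dB I v \<and> (\<forall>k\<in>I. 0 < s k) \<and> (\<Sum>k\<in>I. (s k)\<^sup>2) = 1 \<and>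
     (\<forall>a<dA. \<forall>b<dB. \<phi> $ (a * dB + b) = (\<Sum>k\<in>I. complex_of_real (s k) * u k a * v k b))"

text \<open>Reshape the vector into its coefficient matrix \<open>C\<close> and take a singular
  value decomposition; conjugating the right family turns it into the second Schmidt family.\<close>

lemma schmidt_exists:
  assumes "is_pure_state dA dB \<phi>"
  obtains r :: nat and s u v where "schmidt dA dB \<phi> {..<r} s u v"
proof -
  have \<phi>: "\<phi> \<in> carrier_vec (dA * dB)" "\<phi> \<bullet>c \<phi> = 1"
    using assms by (auto simp: is_pure_state_def)
  define C where "C = mat dA dB (\<lambda>(a, b). \<phi> $ (a * dB + b))"
  obtain r :: nat and s u v where svd: "has_svd C dA dB {..<r} s u v"
    by (rule svd_exists[of C dA dB]) (auto simp: C_def)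
  note D = has_svdD[OF svd]
  have "\<phi> \<bullet>c \<phi> = (\<Sum>i<dA * dB. (\<lambda>a b. \<phi> $ (a * dB + b) * cnj (\<phi> $ (a * dB + b))) (i div dB) (i mod dB))"
    using \<phi>(1) by (auto simp: scalar_prod_def lessThan_atLeast0 intro!: sum.cong)
  also have "\<dots> = (\<Sum>a<dA. \<Sum>b<dB. C $$ (a, b) * cnj (C $$ (a, b)))"
    by (subst sum_div_mod) (simp add: C_def)
  also have "\<dots> = complex_of_real (\<Sum>k<r. (s k)\<^sup>2)"
    by (rule has_svd_frobenius[OF svd])
  finally have "complex_of_real (\<Sum>k<r. (s k)\<^sup>2) = 1" using \<phi>(2) by simp
  then have "(\<Sum>k<r. (s k)\<^sup>2) = 1" by (simp only: of_real_eq_1_iff)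
  moreover have "\<phi> $ (a * dB + b) = (\<Sum>k<r. complex_of_real (s k) * u k a * cnj (v k b))"
    if "a < dA" "b < dB" for a b
    using D(6)[OF that] that by (simp add: C_def)
  ultimately have "schmidt dA dB \<phi> {..<r} s u (\<lambda>k i. cnj (v k i))"
    using \<phi> D by (simp add: schmidt_def orthonormal_cnj)
  then show thesis by (rule that)
qed

text \<open>Partial transposition and realignment only permute the four indices \<open>a\<close>,
  \<open>b\<close>, \<open>a'\<close>, \<open>b'\<close>, so both can be read off from this double
  sum.\<close>

lemma schmidt_ketbra:
  assumes S: "schmidt dA dB \<phi> I s u v" and ab: "a < dA" "b < dB" and ab': "a' < dA" "b' < dB"
  shows "ketbra \<phi> $$ (a * dB + b, a' * dB + b') =
    (\<Sum>(k, l)\<in>I \<times> I. complex_of_real (s k * s l) * (u k a * v k b) * cnj (u l a' * v l b'))"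
proof -
  have dim: "dim_vec \<phi> = dA * dB"
    and entry: "\<And>a b. a < dA \<Longrightarrow> b < dB \<Longrightarrow> \<phi> $ (a * dB + b) = (\<Sum>k\<in>I. complex_of_real (s k) * u k a * v k b)"
    using S by (auto simp: schmidt_def)
  have "ketbra \<phi> $$ (a * dB + b, a' * dB + b') = \<phi> $ (a * dB + b) * cnj (\<phi> $ (a' * dB + b'))"
    using product_index_less[OF ab] product_index_less[OF ab'] by (simp add: ketbra_def dim)
  also have "\<dots> = (\<Sum>k\<in>I. \<Sum>l\<in>I. complex_of_real (s k) * u k a * v k b *
      cnj (complex_of_real (s l) * u l a' * v l b'))"
    unfolding entry[OF ab] entry[OF ab'] cnj_sum sum_product ..
  also have "\<dots> = (\<Sum>(k, l)\<in>I \<times> I. complex_of_real (s k) * u k a * v k b *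
      cnj (complex_of_real (s l) * u l a' * v l b'))"
    by (rule sum.cartesian_product)
  finally show ?thesis
    by (simp add: mult_ac)
qed

text \<open>Transposing on B swaps the factors v_k and conj v_l. The term (k, l) becomes s_k s_l
  times the outer product of u_k (x) conj v_l with u_l (x) conj v_k. Both families are orthonormal
  over pairs, so this is a singular value decomposition.\<close>

lemma trace_norm_partial_transpose_pure:
  assumes S: "schmidt dA dB \<phi> I s u v"
  shows "trace_norm (partial_transpose_B dA dB (ketbra \<phi>)) = (\<Sum>k\<in>I. s k)\<^sup>2"
proof -
  note D = S[unfolded schmidt_def]
  define x where "x = (\<lambda>(k, l) r. u k (r div dB) * cnj (v l (r mod dB)))"
  have on: "cinner (dA * dB) (x (k, l)) (x (k', l')) = (if k = k' \<and> l = l' then 1 else 0)"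
    if "k \<in> I" "l \<in> I" "k' \<in> I" "l' \<in> I" for k l k' l'
    using that D unfolding x_def prod.case
    by (subst cinner_tensor[of dA dB _ "\<lambda>b. cnj (v l b)" _ "\<lambda>b. cnj (v l' b)"])
      (auto simp: cinner_cnj orthonormalD)
  have "has_svd (partial_transpose_B dA dB (ketbra \<phi>)) (dA * dB) (dA * dB) (I \<times> I)
      (\<lambda>(k, l). s k * s l) x (\<lambda>(k, l). x (l, k))"
    unfolding has_svd_def
  proof (intro conjI allI impI)
    fix r c assume rc: "r < dA * dB" "c < dA * dB"
    then have dB: "0 < dB" by (auto intro: gr0I)
    have lt: "r div dB < dA" "c div dB < dA" "r mod dB < dB" "c mod dB < dB"
      using rc dB by (auto simp: less_mult_imp_div_less)
    have "partial_transpose_B dA dB (ketbra \<phi>) $$ (r, c)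
        = ketbra \<phi> $$ (r div dB * dB + c mod dB, c div dB * dB + r mod dB)"
      using rc lt by (simp add: partial_transpose_B_def block_def)
    also have "\<dots> = (\<Sum>z\<in>I \<times> I. complex_of_real (case z of (k, l) \<Rightarrow> s k * s l) * x z r *
        cnj ((case z of (k, l) \<Rightarrow> x (l, k)) c))"
      unfolding schmidt_ketbra[OF S lt(1,4,2,3)]
      by (intro sum.cong) (auto simp: x_def)
    finally show "partial_transpose_B dA dB (ketbra \<phi>) $$ (r, c) = \<dots>" .
  qed (use D on in \<open>auto simp: partial_transpose_B_def orthonormal_def\<close>)
  then have "trace_norm (partial_transpose_B dA dB (ketbra \<phi>)) = (\<Sum>(k, l)\<in>I \<times> I. s k * s l)"
    by (rule trace_norm_svd)
  then show ?thesis
    by (simp add: power2_eq_square sum_product sum.cartesian_product)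
qed

section \<open>The matrix M\<close>

lemma realign_carrier: "realign m n Z \<in> carrier_mat (m\<^sup>2) (n\<^sup>2)"
  by (auto simp: realign_def)

lemma realign_index:
  assumes "r < m\<^sup>2" "c < n\<^sup>2"
  shows "realign m n Z $$ (r, c) = Z $$ (r mod m * n + c mod n, r div m * n + c div n)"
proof -
  have n: "0 < n" using assms by (auto intro: gr0I)
  have "c div n < n" using assms by (simp add: less_mult_imp_div_less power2_eq_square)
  then show ?thesis
    using assms n by (simp add: realign_def mat_of_rows_def vectorize_def block_def power2_eq_square)
qed

lemma omega_carrier: "X \<in> carrier_mat m n \<Longrightarrow> omega l X \<in> carrier_mat (m * n) l"
  by (auto simp: omega_def)

lemma omega_index:
  assumes "X \<in> carrier_mat m n" "i < m * n" "j < l"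
  shows "omega l X $$ (i, j) = X $$ (i mod m, i div m)"
  using assms by (auto simp: omega_def mat_of_cols_def vectorize_def)

lemma M_mat_carrier: "M_mat dA dB l \<alpha> \<beta> \<rho> \<in> carrier_mat (l + dA\<^sup>2) (l + dB\<^sup>2)"
  unfolding M_mat_def using realign_carrier[of dA dB \<rho>]
  by (intro four_block_carrier_mat) (auto simp: ones_mat_def)

text \<open>In this form the corner is constant and every other entry is linear in the state. The
  offset \<open>l\<close> skips the constant block; \<open>mod\<close> gives the row index and
  \<open>div\<close> the column index, as in column stacking.\<close>

lemma M_mat_index:
  assumes i: "i < l + dA\<^sup>2" and j: "j < l + dB\<^sup>2"
  shows "M_mat dA dB l \<alpha> \<beta> \<rho> $$ (i, j) =
    (if i < l then
       if j < l then complex_of_real (\<alpha> * \<beta>)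
       else complex_of_real \<alpha> * (\<Sum>a<dA. \<rho> $$ (a * dB + (j - l) mod dB, a * dB + (j - l) div dB))
     else
       if j < l then complex_of_real \<beta> * (\<Sum>b<dB. \<rho> $$ ((i - l) mod dA * dB + b, (i - l) div dA * dB + b))
       else \<rho> $$ ((i - l) mod dA * dB + (j - l) mod dB, (i - l) div dA * dB + (j - l) div dB))"
proof -
  have A: "partial_trace_A dA dB \<rho> \<in> carrier_mat dB dB" and B: "partial_trace_B dA dB \<rho> \<in> carrier_mat dA dA"
    by (auto simp: partial_trace_A_def partial_trace_B_def)
  have oA: "omega l (partial_trace_A dA dB \<rho>) $$ (c, k)
      = (\<Sum>a<dA. \<rho> $$ (a * dB + c mod dB, a * dB + c div dB))" if "c < dB\<^sup>2" "k < l" for c k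
    using omega_index[OF A that[unfolded power2_eq_square]] square_index_div_mod_less[OF that(1)]
    by (simp add: partial_trace_A_def block_def)
  have oB: "omega l (partial_trace_B dA dB \<rho>) $$ (r, k)
      = (\<Sum>b<dB. \<rho> $$ (r mod dA * dB + b, r div dA * dB + b))" if "r < dA\<^sup>2" "k < l" for r k
    using omega_index[OF B that[unfolded power2_eq_square]] square_index_div_mod_less[OF that(1)]
    by (simp add: partial_trace_B_def block_def mat_trace_def)
  have dims: "dim_row (omega l (partial_trace_A dA dB \<rho>)) = dB * dB"
    "dim_col (omega l (partial_trace_A dA dB \<rho>)) = l"
    "dim_row (omega l (partial_trace_B dA dB \<rho>)) = dA * dA"
    "dim_col (omega l (partial_trace_B dA dB \<rho>)) = l"
    using omega_carrier[OF A, of l] omega_carrier[OF B, of l] by auto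
  have R: "dim_row (realign dA dB \<rho>) = dA * dA" "dim_col (realign dA dB \<rho>) = dB * dB"
    using realign_carrier[of dA dB \<rho>] by (auto simp: power2_eq_square)
  show ?thesis
    using i j unfolding M_mat_def
    by (auto simp: ones_mat_def dims R oA oB realign_index power2_eq_square)
qed

lemma trace_norm_M_mat_pure:
  assumes S: "schmidt dA dB \<phi> I s u v"
  shows "trace_norm (M_mat dA dB l \<alpha> \<beta> (ketbra \<phi>))
    \<le> (\<Sum>k\<in>I. s k)\<^sup>2 - 1 + sqrt ((real l * \<alpha>\<^sup>2 + 1) * (real l * \<beta>\<^sup>2 + 1))"
proof -
  note D = S[unfolded schmidt_def]
  let ?K = "sqrt ((real l * \<alpha>\<^sup>2 + 1) * (real l * \<beta>\<^sup>2 + 1))"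
  \<comment> \<open>Realignment pairs the two A indices as rows and the two B indices as columns, so
    the term (k, m) factors into \<open>xu\<close> times the transpose of \<open>yv\<close>; the
    conjugated factor carries the slow index.\<close>
  define xu where "xu k m r = cnj (u m (r div dA)) * u k (r mod dA)" for k m r
  define yv where "yv k m c = cnj (v m (c div dB)) * v k (c mod dB)" for k m c
  \<comment> \<open>The leading entries are \<alpha> or \<beta> times the Kronecker delta of
    \<open>k\<close> and \<open>m\<close>, which is what the partial traces contribute through <u_k,
    u_m> and <v_k, v_m>. The weight s_k s_m is carried by \<open>x\<close> alone.\<close>
  define x where "x = (\<lambda>(k, m) i. complex_of_real (s k * s m) *
    (if i < l then (if k = m then complex_of_real \<alpha> else 0) else xu k m (i - l)))"
  define y where "y = (\<lambda>(k, m) j. if j < l then (if k = m then complex_of_real \<beta> else 0) else yv k m (j - l))"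
  have sum_delta: "(\<Sum>(k, m)\<in>I \<times> I. f k m * (if k = m then 1 else 0)) = (\<Sum>k\<in>I. f k k)"
    for f :: "_ \<Rightarrow> _ \<Rightarrow> complex"
    using D by (simp add: if_distrib cong: if_cong flip: sum.cartesian_product)
  have "trace_norm (M_mat dA dB l \<alpha> \<beta> (ketbra \<phi>))
      \<le> (\<Sum>q\<in>I \<times> I. cnorm (l + dA\<^sup>2) (x q) * cnorm (l + dB\<^sup>2) (y q))"
  proof (rule trace_norm_rank_one_sum_le[OF M_mat_carrier])
    fix i j assume i: "i < l + dA\<^sup>2" and j: "j < l + dB\<^sup>2"
    note entry = M_mat_index[OF i j, of \<alpha> \<beta> "ketbra \<phi>"]
    consider "i < l" "j < l" | "i < l" "l \<le> j" | "l \<le> i" "j < l" | "l \<le> i" "l \<le> j" by linarith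
    then show "M_mat dA dB l \<alpha> \<beta> (ketbra \<phi>) $$ (i, j) = (\<Sum>q\<in>I \<times> I. x q i * y q j)"
    proof cases
      case 1
      have "(\<Sum>q\<in>I \<times> I. x q i * y q j) = (\<Sum>(k, m)\<in>I \<times> I.
          complex_of_real (s k * s m * \<alpha> * \<beta>) * (if k = m then 1 else 0))"
        using 1 by (intro sum.cong) (auto simp: x_def y_def)
      \<comment> \<open>The corner is reproduced exactly because the squared Schmidt coefficients
        sum to 1.\<close>
      also have "\<dots> = complex_of_real ((\<Sum>k\<in>I. (s k)\<^sup>2) * \<alpha> * \<beta>)"
        unfolding sum_delta by (simp add: power2_eq_square sum_distrib_right)
      finally show ?thesis using 1 entry D by simp
    next
      case 2
      then have c: "j - l < dB\<^sup>2" using j by linarith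
      have "(\<Sum>a<dA. ketbra \<phi> $$ (a * dB + (j - l) mod dB, a * dB + (j - l) div dB))
          = (\<Sum>a<dA. \<Sum>(k, m)\<in>I \<times> I. complex_of_real (s k * s m) *
              (u k a * v k ((j - l) mod dB)) * cnj (u m a * v m ((j - l) div dB)))"
        using square_index_div_mod_less[OF c] by (intro sum.cong refl schmidt_ketbra[OF S]) auto
      also have "\<dots> = (\<Sum>(k, m)\<in>I \<times> I. complex_of_real (s k * s m) * cinner dA (u k) (u m) * yv k m (j - l))"
        by (subst sum.swap)
          (auto simp: cinner_def yv_def sum_distrib_left sum_distrib_right mult_ac intro!: sum.cong)
      also have "complex_of_real \<alpha> * \<dots> = (\<Sum>q\<in>I \<times> I. x q i * y q j)"
        unfolding sum_distrib_left using 2 D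
        by (intro sum.cong) (auto simp: x_def y_def orthonormalD)
      finally show ?thesis using 2 entry by simp
    next
      case 3
      then have r: "i - l < dA\<^sup>2" using i by linarith
      have "(\<Sum>b<dB. ketbra \<phi> $$ ((i - l) mod dA * dB + b, (i - l) div dA * dB + b))
          = (\<Sum>b<dB. \<Sum>(k, m)\<in>I \<times> I. complex_of_real (s k * s m) *
              (u k ((i - l) mod dA) * v k b) * cnj (u m ((i - l) div dA) * v m b))"
        using square_index_div_mod_less[OF r] by (intro sum.cong refl schmidt_ketbra[OF S]) auto
      also have "\<dots> = (\<Sum>(k, m)\<in>I \<times> I. complex_of_real (s k * s m) * cinner dB (v k) (v m) * xu k m (i - l))"
        by (subst sum.swap)
          (auto simp: cinner_def xu_def sum_distrib_left sum_distrib_right mult_ac intro!: sum.cong)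
      also have "complex_of_real \<beta> * \<dots> = (\<Sum>q\<in>I \<times> I. x q i * y q j)"
        unfolding sum_distrib_left using 3 D
        by (intro sum.cong) (auto simp: x_def y_def orthonormalD)
      finally show ?thesis using 3 entry by simp
    next
      case 4
      then have "i - l < dA\<^sup>2" "j - l < dB\<^sup>2" using i j by linarith+
      note lt = square_index_div_mod_less[OF this(1)] square_index_div_mod_less[OF this(2)]
      have "ketbra \<phi> $$ ((i - l) mod dA * dB + (j - l) mod dB, (i - l) div dA * dB + (j - l) div dB)
          = (\<Sum>q\<in>I \<times> I. x q i * y q j)"
        unfolding schmidt_ketbra[OF S lt(1,3,2,4)] using 4
        by (intro sum.cong) (auto simp: x_def y_def xu_def yv_def)
      then show ?thesis using 4 entry by simp
    qed
  qed (use D in auto)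
  \<comment> \<open>The tails \<open>xu\<close> and \<open>yv\<close> are unit vectors. An
    off-diagonal pair contributes s_k s_m, a diagonal one s_k^2 times \<open>?K\<close>, written as
    s_k^2 plus the excess over it.\<close>
  also have "\<dots> = (\<Sum>(k, m)\<in>I \<times> I. s k * s m + (if k = m then (s k)\<^sup>2 * (?K - 1) else 0))"
  proof (intro sum.cong refl, clarify)
    fix k m assume km: "k \<in> I" "m \<in> I"
    have "cnorm (dA\<^sup>2) (xu k m) = 1" "cnorm (dB\<^sup>2) (yv k m) = 1"
      using km D unfolding xu_def yv_def power2_eq_square
      by (auto simp: cnorm_tensor[where x = "\<lambda>i. cnj (u m i)"] cnorm_tensor[where x = "\<lambda>i. cnj (v m i)"]
          cnorm_cnj orthonormal_cnorm)
    moreover have sk: "0 < s k" "0 < s m" using km D by auto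
    ultimately show "cnorm (l + dA\<^sup>2) (x (k, m)) * cnorm (l + dB\<^sup>2) (y (k, m))
        = s k * s m + (if k = m then (s k)\<^sup>2 * (?K - 1) else 0)"
      using sk unfolding x_def y_def prod.case cnorm_scale cnorm_append real_sqrt_mult
      by (cases "k = m") (simp_all add: norm_mult power2_eq_square[of "s _"] right_diff_distrib)
  qed
  also have "\<dots> = (\<Sum>k\<in>I. \<Sum>m\<in>I. s k * s m + (if k = m then (s k)\<^sup>2 * (?K - 1) else 0))"
    by (rule sum.cartesian_product[symmetric])
  also have "\<dots> = (\<Sum>k\<in>I. \<Sum>m\<in>I. s k * s m) + (\<Sum>k\<in>I. (s k)\<^sup>2 * (?K - 1))"
    using D by (simp add: sum.distrib)
  also have "\<dots> = (\<Sum>k\<in>I. s k)\<^sup>2 + (\<Sum>k\<in>I. (s k)\<^sup>2) * (?K - 1)"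
    by (simp only: power2_eq_square[of "sum s I"] sum_product flip: sum_distrib_right)
  also have "\<dots> = (\<Sum>k\<in>I. s k)\<^sup>2 - 1 + ?K"
    using D by simp
  finally show ?thesis .
qed

text \<open>The squared sum of Schmidt coefficients occurs in both trace norms and cancels.\<close>

lemma trace_norm_M_mat_pure_le_transpose:
  assumes "is_pure_state dA dB \<phi>"
  shows "trace_norm (M_mat dA dB l \<alpha> \<beta> (ketbra \<phi>)) - sqrt ((real l * \<alpha>\<^sup>2 + 1) * (real l * \<beta>\<^sup>2 + 1))
    \<le> trace_norm (partial_transpose_B dA dB (ketbra \<phi>)) - 1"
proof -
  obtain r :: nat and s u v where S: "schmidt dA dB \<phi> {..<r} s u v"
    by (rule schmidt_exists[OF assms])
  show ?thesis
    using trace_norm_M_mat_pure[OF S, of l \<alpha> \<beta>] trace_norm_partial_transpose_pure[OF S] by simp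
qed

text \<open>Entry by entry, M of the mixture is the same convex combination of the matrices M of the
  pure states, so the triangle inequality applies.\<close>

lemma trace_norm_M_mat_convex:
  assumes "is_pure_decomposition dA dB \<rho> n p \<phi>"
  shows "trace_norm (M_mat dA dB l \<alpha> \<beta> \<rho>) \<le> (\<Sum>q<n. p q * trace_norm (M_mat dA dB l \<alpha> \<beta> (ketbra (\<phi> q))))"
proof -
  have p: "\<And>q. q < n \<Longrightarrow> 0 \<le> p q" "(\<Sum>q<n. p q) = 1"
    and \<rho>: "\<rho> = mat (dA * dB) (dA * dB) (\<lambda>rc. \<Sum>q<n. complex_of_real (p q) * ketbra (\<phi> q) $$ rc)"
    using assms by (auto simp: is_pure_decomposition_def)
  have \<rho>_index: "\<rho> $$ (a * dB + b, a' * dB + b')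
      = (\<Sum>q<n. complex_of_real (p q) * ketbra (\<phi> q) $$ (a * dB + b, a' * dB + b'))"
    if "a < dA" "b < dB" "a' < dA" "b' < dB" for a b a' b'
    using that by (simp add: \<rho> product_index_less)
  have "trace_norm (M_mat dA dB l \<alpha> \<beta> \<rho>)
      \<le> (\<Sum>q<n. cmod (complex_of_real (p q)) * trace_norm (M_mat dA dB l \<alpha> \<beta> (ketbra (\<phi> q))))"
  proof (rule trace_norm_combination_le[OF M_mat_carrier _ M_mat_carrier])
    fix i j assume i: "i < l + dA\<^sup>2" and j: "j < l + dB\<^sup>2"
    note entry = M_mat_index[OF i j, of \<alpha> \<beta>]
    consider "i < l" "j < l" | "i < l" "l \<le> j" | "l \<le> i" "j < l" | "l \<le> i" "l \<le> j" by linarith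
    then show "M_mat dA dB l \<alpha> \<beta> \<rho> $$ (i, j)
        = (\<Sum>q<n. complex_of_real (p q) * M_mat dA dB l \<alpha> \<beta> (ketbra (\<phi> q)) $$ (i, j))"
    proof cases
      case 1
      \<comment> \<open>The constant corner is preserved only because the weights sum to 1.\<close>
      have "(\<Sum>q<n. complex_of_real (p q)) = 1" using p(2) by (simp flip: of_real_sum)
      with 1 show ?thesis by (simp add: entry flip: sum_distrib_right)
    next
      case 2
      then have c: "j - l < dB\<^sup>2" using j by linarith
      have "complex_of_real \<alpha> * (\<Sum>a<dA. \<rho> $$ (a * dB + (j - l) mod dB, a * dB + (j - l) div dB))
          = complex_of_real \<alpha> * (\<Sum>a<dA. \<Sum>q<n. complex_of_real (p q) *
              ketbra (\<phi> q) $$ (a * dB + (j - l) mod dB, a * dB + (j - l) div dB))"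
        using square_index_div_mod_less[OF c] by (simp add: \<rho>_index)
      with 2 show ?thesis
        by (subst (asm) sum.swap) (simp add: entry sum_distrib_left mult_ac)
    next
      case 3
      then have r: "i - l < dA\<^sup>2" using i by linarith
      have "complex_of_real \<beta> * (\<Sum>b<dB. \<rho> $$ ((i - l) mod dA * dB + b, (i - l) div dA * dB + b))
          = complex_of_real \<beta> * (\<Sum>b<dB. \<Sum>q<n. complex_of_real (p q) *
              ketbra (\<phi> q) $$ ((i - l) mod dA * dB + b, (i - l) div dA * dB + b))"
        using square_index_div_mod_less[OF r] by (simp add: \<rho>_index)
      with 3 show ?thesis
        by (subst (asm) sum.swap) (simp add: entry sum_distrib_left mult_ac)
    next
      case 4
      then have "i - l < dA\<^sup>2" "j - l < dB\<^sup>2" using i j by linarith+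
      from square_index_div_mod_less[OF this(1)] square_index_div_mod_less[OF this(2)] 4 show ?thesis
        by (simp add: entry \<rho>_index)
    qed
  qed auto
  also have "\<dots> = (\<Sum>q<n. p q * trace_norm (M_mat dA dB l \<alpha> \<beta> (ketbra (\<phi> q))))"
    using p(1) by simp
  finally show ?thesis .
qed

text \<open>The spectral decomposition serves: eigenvalues are positive and sum to the trace 1,
  eigenvectors are unit vectors. This makes the set under the infimum in \<open>cren\<close>
  nonempty.\<close>

lemma pure_decomposition_exists:
  assumes "is_state dA dB \<rho>"
  obtains n p \<phi> where "is_pure_decomposition dA dB \<rho> n p \<phi>"
proof -
  let ?N = "dA * dB"
  have \<rho>: "psd ?N \<rho>" "mat_trace \<rho> = 1" using assms by (auto simp: is_state_def)
  obtain n :: nat and p u where svd: "has_svd \<rho> ?N ?N {..<n} p u u"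
    by (rule psd_spectral[OF \<rho>(1)])
  note D = has_svdD[OF svd]
  have "complex_of_real (\<Sum>k<n. p k) = 1" using has_svd_trace[OF svd] \<rho>(2) by simp
  then have "(\<Sum>k<n. p k) = 1" by (simp only: of_real_eq_1_iff)
  moreover have "is_pure_state dA dB (vec ?N (u k))" if "k < n" for k
  proof -
    have "vec ?N (u k) \<bullet>c vec ?N (u k) = cinner ?N (u k) (u k)"
      by (simp add: scalar_prod_def cinner_def lessThan_atLeast0)
    then show ?thesis using that D(3) by (simp add: is_pure_state_def orthonormalD)
  qed
  moreover have "\<rho> = mat ?N ?N (\<lambda>rc. \<Sum>k<n. complex_of_real (p k) * ketbra (vec ?N (u k)) $$ rc)"
    using D(1) by (intro eq_matI) (auto simp: D(6) ketbra_def mult.assoc)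
  ultimately have "is_pure_decomposition dA dB \<rho> n p (\<lambda>k. vec ?N (u k))"
    using D(5) by (auto simp: is_pure_decomposition_def less_imp_le)
  then show thesis by (rule that)
qed

theorem theorem3:
  fixes dA dB l :: nat and \<alpha> \<beta> :: real and \<rho> :: "complex mat"
  assumes "dA \<ge> 2" and "dB \<ge> 2" and "l \<ge> 1"
    and "is_state dA dB \<rho>"
  shows "cren dA dB \<rho> \<ge>
    (trace_norm (M_mat dA dB l \<alpha> \<beta> \<rho>) - sqrt ((real l * \<alpha>\<^sup>2 + 1) * (real l * \<beta>\<^sup>2 + 1)))
      / (real (min dA dB) - 1)"
  unfolding cren_def
proof (rule cInf_greatest)
  obtain n p \<phi> where "is_pure_decomposition dA dB \<rho> n p \<phi>"
    by (rule pure_decomposition_exists[OF assms(4)])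
  then show "cren_values dA dB \<rho> \<noteq> {}"
    unfolding cren_values_def by auto
next
  fix x assume "x \<in> cren_values dA dB \<rho>"
  then obtain n p \<phi> where dec: "is_pure_decomposition dA dB \<rho> n p \<phi>"
    and x: "x = (\<Sum>q<n. p q * cren_pure dA dB (\<phi> q))"
    unfolding cren_values_def by blast
  let ?K = "sqrt ((real l * \<alpha>\<^sup>2 + 1) * (real l * \<beta>\<^sup>2 + 1))" and ?d = "real (min dA dB) - 1"
  let ?M = "\<lambda>q. trace_norm (M_mat dA dB l \<alpha> \<beta> (ketbra (\<phi> q)))"
  have p: "\<And>q. q < n \<Longrightarrow> 0 \<le> p q" "(\<Sum>q<n. p q) = 1" "\<And>q. q < n \<Longrightarrow> is_pure_state dA dB (\<phi> q)"
    using dec by (auto simp: is_pure_decomposition_def)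
  \<comment> \<open>Both dimensions being at least 2 keeps the denominator positive, so dividing
    preserves the inequality.\<close>
  have d: "0 < ?d" using assms by simp
  \<comment> \<open>Writing \<open>?K\<close> as its own average over the weights lets the pure
    state bound act on each term separately.\<close>
  have "trace_norm (M_mat dA dB l \<alpha> \<beta> \<rho>) - ?K \<le> (\<Sum>q<n. p q * ?M q) - (\<Sum>q<n. p q) * ?K"
    using trace_norm_M_mat_convex[OF dec, of l \<alpha> \<beta>] p(2) by simp
  also have "\<dots> = (\<Sum>q<n. p q * (?M q - ?K))"
    by (simp add: sum_distrib_right sum_subtractf right_diff_distrib)
  also have "\<dots> \<le> (\<Sum>q<n. p q * (trace_norm (partial_transpose_B dA dB (ketbra (\<phi> q))) - 1))"
    using p by (intro sum_mono mult_left_mono trace_norm_M_mat_pure_le_transpose) auto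
  finally have "(trace_norm (M_mat dA dB l \<alpha> \<beta> \<rho>) - ?K) / ?d \<le>
      (\<Sum>q<n. p q * (trace_norm (partial_transpose_B dA dB (ketbra (\<phi> q))) - 1)) / ?d"
    using d by (intro divide_right_mono) auto
  also have "\<dots> = x"
    by (simp add: x cren_pure_def sum_divide_distrib)
  finally show "(trace_norm (M_mat dA dB l \<alpha> \<beta> \<rho>) - ?K) / ?d \<le> x" .
qed

end
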